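(* Let $p>1$, $s\ge r\ge2$ and $0<\varepsilon<1$. Let $Q$ be an $s$-vertex $r$-graph and let $\mathcal F$ be a family of $r$-graphs, none having isolated vertices, with $\pi:=\pi(Q,\overline{\mathcal F})>0$. Let $\mathcal G_n$ be the set of all $n$-vertex $\mathcal F$-free $r$-graphs $G$ with $\delta_Q(G)\ge(1-\varepsilon)\pi\binom{n}{s-1}$, and $\lambda^{(p)}(Q,\mathcal G_n)=\max\{\lambda^{(p)}(Q,G):G\in\mathcal G_n\}$. Put $\sigma=\varepsilon\pi/(5\,s!\,(s-1))$. Then there is $N$ (depending on $p,s,Q,\mathcal F,\varepsilon$) such that the following holds: if $n_0\ge N$ and for every $n\ge n_0$ $$\lambda^{(p)}(Q,\overline{\mathcal F}_n)\ge\lambda^{(p)}(Q,\overline{\mathcal F}_{n-1})+\pi\,(s-s/p)(1-\sigma)\,n^{s-s/p-1},$$ then for every $\mathcal F$-free $r$-graph $H$ on $n\ge n_0$ vertices, $\lambda^{(p)}(Q,H)\le\lambda^{(p)}(Q,\mathcal G_n)$; moreover, if equality holds, then $H\in\mathcal G_n$.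
   Context: An $r$-graph ($r\ge 2$) is a finite hypergraph all of whose edges have exactly $r$ vertices. For $I\subseteq V(H)$, $H[I]$ denotes the induced subhypergraph on $I$. For an $s$-vertex $r$-graph $Q$ and an $r$-graph $H$, $\mathcal N(Q,H)$ is the number of (not necessarily induced) subgraphs of $H$ isomorphic to $Q$. For an $n$-vertex $r$-graph $H$ with vertex set $[n]$ and $\mathbf x\in\mathbb R^n$, $P_{Q,H}(\mathbf x)=s!\sum_{\{i_1,\dots,i_s\}\in\binom{[n]}{s}}\mathcal N(Q,H[\{i_1,\dots,i_s\}])\,x_{i_1}\cdots x_{i_s}$, and for $p\ge1$, $\lambda^{(p)}(Q,H)=\max_{\|\mathbf x\|_p=1}P_{Q,H}(\mathbf x)$. The $Q$-degree of a vertex $v$ is $d_{Q,H}(v)=\sum\mathcal N(Q,H[I])$ over all $s$-subsets $I\subseteq V(H)$ containing $v$, and $\delta_Q(H)$ is the minimum $Q$-degree. An $r$-graph is $\mathcal F$-free if it contains no subgraph isomorphic to a member of $\mathcal F$; $\overline{\mathcal F}$ is the class of $\mathcal F$-free $r$-graphs and $\overline{\mathcal F}_n$ its members on $n$ vertices. $\lambda^{(p)}(Q,\overline{\mathcal F}_n)=\max\{\lambda^{(p)}(Q,H):H\in\overline{\mathcal F}_n\}$, $ex(Q,\overline{\mathcal F}_n)=\max\{\mathcal N(Q,H):H\in\overline{\mathcal F}_n\}$ and $\pi(Q,\overline{\mathcal F})=\lim_{n\to\infty}ex(Q,\overline{\mathcal F}_n)/\binom ns$ (this limit exists). *)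

theory Defs
  imports Complex_Main
begin

type_synonym hg = "nat set \<times> nat set set"

definition is_rgraph :: "nat \<Rightarrow> hg \<Rightarrow> bool" where
  "is_rgraph r H \<longleftrightarrow> finite (fst H) \<and> (\<forall>e\<in>snd H. e \<subseteq> fst H \<and> card e = r)"

definition no_isolated :: "hg \<Rightarrow> bool" where
  "no_isolated H \<longleftrightarrow> (\<forall>v\<in>fst H. \<exists>e\<in>snd H. v \<in> e)"

definition hg_iso :: "hg \<Rightarrow> hg \<Rightarrow> bool" where
  "hg_iso G H \<longleftrightarrow> (\<exists>f. bij_betw f (fst G) (fst H) \<and> (\<lambda>e. f ` e) ` snd G = snd H)"

definition subgraphs :: "hg \<Rightarrow> hg set" where
  "subgraphs H = {G. fst G \<subseteq> fst H \<and> snd G \<subseteq> snd H \<and> (\<forall>e\<in>snd G. e \<subseteq> fst G)}"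

definition num_copies :: "hg \<Rightarrow> hg \<Rightarrow> nat" where
  "num_copies Q H = card {G \<in> subgraphs H. hg_iso Q G}"

definition induced :: "hg \<Rightarrow> nat set \<Rightarrow> hg" where
  "induced H I = (I, {e \<in> snd H. e \<subseteq> I})"

definition F_free :: "hg set \<Rightarrow> hg \<Rightarrow> bool" where
  "F_free \<F> H \<longleftrightarrow> (\<forall>F\<in>\<F>. \<not> (\<exists>G\<in>subgraphs H. hg_iso F G))"

definition Ppoly :: "hg \<Rightarrow> hg \<Rightarrow> (nat \<Rightarrow> real) \<Rightarrow> real" where
  "Ppoly Q H x = fact (card (fst Q)) *
     (\<Sum>I\<in>{I. I \<subseteq> fst H \<and> card I = card (fst Q)}.
        real (num_copies Q (induced H I)) * (\<Prod>i\<in>I. x i))"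

definition lam :: "real \<Rightarrow> hg \<Rightarrow> hg \<Rightarrow> real" where
  "lam p Q H = Sup {Ppoly Q H x | x. (\<Sum>i\<in>fst H. \<bar>x i\<bar> powr p) powr (1/p) = 1}"

definition Qdeg :: "hg \<Rightarrow> hg \<Rightarrow> nat \<Rightarrow> nat" where
  "Qdeg Q H v = (\<Sum>I\<in>{I. I \<subseteq> fst H \<and> card I = card (fst Q) \<and> v \<in> I}.
                   num_copies Q (induced H I))"

definition minQdeg :: "hg \<Rightarrow> hg \<Rightarrow> nat" where
  "minQdeg Q H = Min (Qdeg Q H ` fst H)"

definition Ffree_n :: "nat \<Rightarrow> hg set \<Rightarrow> nat \<Rightarrow> hg set" where
  "Ffree_n r \<F> n = {H. is_rgraph r H \<and> fst H = {0..<n} \<and> F_free \<F> H}"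

definition lam_class :: "real \<Rightarrow> hg \<Rightarrow> hg set \<Rightarrow> real" where
  "lam_class p Q \<G> = Sup (lam p Q ` \<G>)"

definition ex_num :: "nat \<Rightarrow> hg \<Rightarrow> hg set \<Rightarrow> nat \<Rightarrow> nat" where
  "ex_num r Q \<F> n = Max (num_copies Q ` Ffree_n r \<F> n)"

definition pi_dens :: "nat \<Rightarrow> hg \<Rightarrow> hg set \<Rightarrow> real" where
  "pi_dens r Q \<F> = lim (\<lambda>n. real (ex_num r Q \<F> n) / real (n choose card (fst Q)))"

definition in_Gn :: "nat \<Rightarrow> hg \<Rightarrow> hg set \<Rightarrow> real \<Rightarrow> nat \<Rightarrow> hg \<Rightarrow> bool" where
  "in_Gn r Q \<F> \<epsilon> n G \<longleftrightarrow> is_rgraph r G \<and> card (fst G) = n \<and> F_free \<F> G \<and>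
     real (minQdeg Q G) \<ge> (1 - \<epsilon>) * pi_dens r Q \<F> * real (n choose (card (fst Q) - 1))"

definition Gn :: "nat \<Rightarrow> hg \<Rightarrow> hg set \<Rightarrow> real \<Rightarrow> nat \<Rightarrow> hg set" where
  "Gn r Q \<F> \<epsilon> n = {G. fst G = {0..<n} \<and> in_Gn r Q \<F> \<epsilon> n G}"

end

theory Submission
  imports Defs "HOL-Analysis.Analysis" "HOL-Combinatorics.Permutations"
begin

text \<open>
  It suffices to show that an \<open>n\<close>-vertex graph \<open>H\<close> attaining the maximum over the \<open>\<F>\<close>-free graphs has large
  minimum \<open>Q\<close>-degree. Let \<open>x\<close> be a nonnegative optimal vector and write \<open>\<lambda>(n)\<close> for the maximum. By the Lagrange
  condition, deleting a vertex \<open>u\<close> with \<open>t = x u powr p\<close> gives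
  \<open>\<lambda>(n) (1 - s t) \<le> \<lambda>(n - 1) (1 - t) powr (s/p)\<close>. Since \<open>\<lambda>(n)\<close> is asymptotically \<open>\<pi> n powr (s - s/p)\<close>
  (by averaging over \<open>k\<close>-subsets weighted by \<open>x\<close>), the growth hypothesis forces \<open>t \<ge> (1 - 2 \<sigma>) / n\<close> for every
  vertex. As these numbers sum to 1, the optimal vector is nearly constant, and the Lagrange condition at \<open>u\<close>
  then expresses the \<open>Q\<close>-degree of \<open>u\<close> up to an error of order \<open>\<sigma>\<close>.
\<close>

section \<open>Weighted sums over sets of fixed size\<close>

text \<open>Both halves of the conclusion are one statement: a graph attaining the maximum over all
  free graphs lies in \<open>Gn\<close> up to labelling. Applied to some maximiser it shows that the
  two maxima agree; applied to \<open>H\<close> in the case of equality it gives membership.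

  The obstacle is that control of the optimal vector is one-sided. Growth bounds each entry from
  below only; from above there is just a bound on the sum, by the power mean inequality. The degree
  is therefore compared with the weighted link through the total excess of the products over a
  common lower bound, each excess costing at most s! (the maximal number of copies on s vertices).

  Constants: the 2 in 1 - 2\<sigma> absorbs both the factor 1 + \<sigma> in the upper bound for the
  spectral maximum and the 1 - \<sigma> in the hypothesis, since (1 + \<sigma>)(1 - 2\<sigma>) < 1 -
  \<sigma>. At the end the Lagrange condition costs 2\<pi>\<sigma> and the excess costs 2 s! (s-1)
  \<sigma>. As \<pi> is at most s!, each is at most 2/5 of \<epsilon>\<pi>, and the remaining fifth
  absorbs the vanishing errors.\<close>

definition ksubsets :: "'a set \<Rightarrow> nat \<Rightarrow> 'a set set" where
  "ksubsets V k = {I. I \<subseteq> V \<and> card I = k}"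

text \<open>The coefficients stay arbitrary so that \<open>Ppoly\<close>, its partial derivatives
  (coefficients \<open>g (insert u J)\<close>) and the elementary symmetric polynomials are all
  instances.\<close>

definition weighted_sum :: "nat \<Rightarrow> ('a set \<Rightarrow> real) \<Rightarrow> 'a set \<Rightarrow> ('a \<Rightarrow> real) \<Rightarrow> real" where
  "weighted_sum k g V x = (\<Sum>I\<in>ksubsets V k. g I * (\<Prod>i\<in>I. x i))"

abbreviation elem_sym :: "nat \<Rightarrow> 'a set \<Rightarrow> ('a \<Rightarrow> real) \<Rightarrow> real" where
  "elem_sym k \<equiv> weighted_sum k (\<lambda>_. 1)"

lemma finite_ksubsets [simp]: "finite V \<Longrightarrow> finite (ksubsets V k)"
  unfolding ksubsets_def by (rule finite_subset[of _ "Pow V"]) auto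

lemma card_ksubsets: "finite V \<Longrightarrow> card (ksubsets V k) = card V choose k"
  unfolding ksubsets_def by (rule n_subsets)

lemma finite_in_ksubsets: "finite V \<Longrightarrow> I \<in> ksubsets V k \<Longrightarrow> finite I"
  unfolding ksubsets_def using finite_subset by auto

text \<open>Double counting of pairs of nested sets: K containing I corresponds to I together with J
  = K - I.\<close>

lemma sum_ksubsets_ksubsets:
  fixes h :: "'a set \<Rightarrow> 'a set \<Rightarrow> real"
  assumes V: "finite V" and sk: "s \<le> k"
  shows "(\<Sum>K\<in>ksubsets V k. \<Sum>I\<in>ksubsets K s. h I K)
       = (\<Sum>I\<in>ksubsets V s. \<Sum>J\<in>ksubsets (V - I) (k - s). h I (I \<union> J))"
proof -
  have fK: "finite (ksubsets K s)" if "K \<in> ksubsets V k" for K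
    using finite_in_ksubsets[OF V that] by simp
  have "(\<Sum>K\<in>ksubsets V k. \<Sum>I\<in>ksubsets K s. h I K)
      = (\<Sum>(K,I)\<in>Sigma (ksubsets V k) (\<lambda>K. ksubsets K s). h I K)"
    using fK V by (subst sum.Sigma) auto
  also have "\<dots> = (\<Sum>(I,J)\<in>Sigma (ksubsets V s) (\<lambda>I. ksubsets (V - I) (k - s)). h I (I \<union> J))"
  proof (rule sum.reindex_bij_witness[where i = "\<lambda>(I,J). (I \<union> J, I)" and j = "\<lambda>(K,I). (I, K - I)"])
    fix a assume a: "a \<in> Sigma (ksubsets V k) (\<lambda>K. ksubsets K s)"
    obtain K I where [simp]: "a = (K, I)" by (cases a)
    have KI: "K \<subseteq> V" "card K = k" "I \<subseteq> K" "card I = s"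
      using a by (auto simp: ksubsets_def)
    have "finite K" using KI V finite_subset by blast
    then have "card (K - I) = k - s"
      using KI by (simp add: card_Diff_subset finite_subset)
    then show "(case a of (K, I) \<Rightarrow> (I, K - I)) \<in> Sigma (ksubsets V s) (\<lambda>I. ksubsets (V - I) (k - s))"
      using KI by (auto simp: ksubsets_def)
    show "(case case a of (K, I) \<Rightarrow> (I, K - I) of (I, J) \<Rightarrow> (I \<union> J, I)) = a"
      using KI by auto
    have "I \<union> (K - I) = K" using KI by auto
    then show "(case case a of (K, I) \<Rightarrow> (I, K - I) of (I, J) \<Rightarrow> h I (I \<union> J)) = (case a of (K, I) \<Rightarrow> h I K)"
      by simp
  next
    fix b assume b: "b \<in> Sigma (ksubsets V s) (\<lambda>I. ksubsets (V - I) (k - s))"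
    obtain I J where [simp]: "b = (I, J)" by (cases b)
    have IJ: "I \<subseteq> V" "card I = s" "J \<subseteq> V - I" "card J = k - s"
      using b by (auto simp: ksubsets_def)
    have "finite I" "finite J" using IJ V by (auto intro: finite_subset)
    moreover have "I \<inter> J = {}" using IJ by auto
    ultimately have "card (I \<union> J) = k"
      using IJ sk by (simp add: card_Un_disjoint)
    then show "(case b of (I, J) \<Rightarrow> (I \<union> J, I)) \<in> Sigma (ksubsets V k) (\<lambda>K. ksubsets K s)"
      using IJ by (auto simp: ksubsets_def)
    show "(case case b of (I, J) \<Rightarrow> (I \<union> J, I) of (K, I) \<Rightarrow> (I, K - I)) = b"
      using IJ by auto
  qed
  also have "\<dots> = (\<Sum>I\<in>ksubsets V s. \<Sum>J\<in>ksubsets (V - I) (k - s). h I (I \<union> J))"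
    using V by (subst sum.Sigma) auto
  finally show ?thesis .
qed

text \<open>The product over K factors into those over I and K - I. With all weights 1 this is the
  classical averaging over k-subsets; with an optimal vector it transfers local densities to the
  polynomial.\<close>

lemma weighted_sum_average:
  assumes V: "finite V" and sk: "s \<le> k"
  shows "(\<Sum>K\<in>ksubsets V k. (\<Sum>I\<in>ksubsets K s. g I) * (\<Prod>i\<in>K. x i))
       = (\<Sum>I\<in>ksubsets V s. g I * (\<Prod>i\<in>I. x i) * elem_sym (k - s) (V - I) x)"
proof -
  have "(\<Sum>K\<in>ksubsets V k. (\<Sum>I\<in>ksubsets K s. g I) * (\<Prod>i\<in>K. x i))
      = (\<Sum>K\<in>ksubsets V k. \<Sum>I\<in>ksubsets K s. g I * (\<Prod>i\<in>K. x i))"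
    by (simp add: sum_distrib_right)
  also have "\<dots> = (\<Sum>I\<in>ksubsets V s. \<Sum>J\<in>ksubsets (V - I) (k - s). g I * (\<Prod>i\<in>I \<union> J. x i))"
    by (rule sum_ksubsets_ksubsets[OF V sk])
  also have "\<dots> = (\<Sum>I\<in>ksubsets V s. \<Sum>J\<in>ksubsets (V - I) (k - s). g I * (\<Prod>i\<in>I. x i) * (\<Prod>i\<in>J. x i))"
  proof (intro sum.cong refl)
    fix I J assume I: "I \<in> ksubsets V s" and J: "J \<in> ksubsets (V - I) (k - s)"
    have "finite I" using finite_in_ksubsets[OF V I] .
    moreover have "finite J" using finite_in_ksubsets[OF _ J] V by simp
    moreover have "I \<inter> J = {}" using J by (auto simp: ksubsets_def)
    ultimately show "g I * (\<Prod>i\<in>I \<union> J. x i) = g I * (\<Prod>i\<in>I. x i) * (\<Prod>i\<in>J. x i)"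
      by (simp add: prod.union_disjoint mult.assoc)
  qed
  also have "\<dots> = (\<Sum>I\<in>ksubsets V s. g I * (\<Prod>i\<in>I. x i) * elem_sym (k - s) (V - I) x)"
    by (simp add: weighted_sum_def sum_distrib_left)
  finally show ?thesis .
qed

lemma ksubsets_0 [simp]: "finite V \<Longrightarrow> ksubsets V 0 = {{}}"
  by (auto simp: ksubsets_def dest: finite_subset)

lemma ksubsets_1 [simp]: "ksubsets V (Suc 0) = (\<lambda>i. {i}) ` V"
  by (auto simp: ksubsets_def card_1_singleton_iff)

lemma elem_sym_0 [simp]: "finite V \<Longrightarrow> elem_sym 0 V x = 1"
  by (simp add: weighted_sum_def)

lemma elem_sym_1 [simp]: "elem_sym (Suc 0) V x = sum x V"
  by (simp add: weighted_sum_def sum.reindex)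

text \<open>Each (m+1)-set arises from m+1 choices of its last element. This recursion drives both
  bounds on \<open>elem_sym\<close> below.\<close>

lemma elem_sym_Suc:
  assumes V: "finite V"
  shows "real (Suc m) * elem_sym (Suc m) V x
       = (\<Sum>I\<in>ksubsets V m. (\<Prod>i\<in>I. x i) * sum x (V - I))"
proof -
  have *: "real (card (ksubsets K m)) = real (Suc m)" if "K \<in> ksubsets V (Suc m)" for K
    using that finite_in_ksubsets[OF V that] by (simp add: card_ksubsets) (simp add: ksubsets_def)
  have "real (Suc m) * elem_sym (Suc m) V x
      = (\<Sum>K\<in>ksubsets V (Suc m). (\<Sum>I\<in>ksubsets K m. 1) * (\<Prod>i\<in>K. x i))"
    unfolding weighted_sum_def sum_distrib_left by (intro sum.cong refl) (simp add: *)
  also have "\<dots> = (\<Sum>I\<in>ksubsets V m. (\<Prod>i\<in>I. x i) * sum x (V - I))"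
    using weighted_sum_average[OF V, of m "Suc m" "\<lambda>_. 1" x] by simp
  finally show ?thesis .
qed

lemma prod_ksubset_nonneg:
  fixes x :: "'a \<Rightarrow> real"
  assumes "\<And>i. i \<in> V \<Longrightarrow> 0 \<le> x i" "I \<in> ksubsets V m"
  shows "0 \<le> (\<Prod>i\<in>I. x i)"
  using assms by (intro prod_nonneg) (auto simp: ksubsets_def)

lemma elem_sym_le:
  assumes V: "finite V" and x: "\<And>i. i \<in> V \<Longrightarrow> 0 \<le> x i"
  shows "elem_sym m V x \<le> sum x V ^ m / fact m"
proof (induction m)
  case 0 then show ?case using V by simp
next
  case (Suc m)
  have "real (Suc m) * elem_sym (Suc m) V x \<le> (\<Sum>I\<in>ksubsets V m. (\<Prod>i\<in>I. x i) * sum x V)"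
    unfolding elem_sym_Suc[OF V]
    using prod_ksubset_nonneg[OF x] V x
    by (intro sum_mono mult_left_mono sum_mono2) auto
  also have "\<dots> = elem_sym m V x * sum x V"
    by (simp add: weighted_sum_def sum_distrib_right)
  also have "\<dots> \<le> sum x V ^ m / fact m * sum x V"
    using Suc x by (intro mult_right_mono sum_nonneg) auto
  finally have "real (Suc m) * elem_sym (Suc m) V x / real (Suc m)
      \<le> sum x V ^ m / fact m * sum x V / real (Suc m)"
    by (intro divide_right_mono) auto
  moreover have "sum x V ^ m / fact m * sum x V / real (Suc m) = sum x V ^ Suc m / fact (Suc m)"
    by (simp add: mult_ac del: of_nat_Suc)
  ultimately show ?case
    by (simp del: fact_Suc power_Suc of_nat_Suc)
qed

text \<open>An m-set removes at most m M from the total, so the recursion loses little when all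
  weights are small.\<close>

lemma elem_sym_ge:
  assumes V: "finite V" and x: "\<And>i. i \<in> V \<Longrightarrow> 0 \<le> x i \<and> x i \<le> M"
    and M: "0 \<le> M" and S: "real m * M \<le> sum x V"
  shows "(sum x V - real m * M) ^ m / fact m \<le> elem_sym m V x"
  using S
proof (induction m)
  case 0 then show ?case using V by simp
next
  case (Suc m)
  have x0: "\<And>i. i \<in> V \<Longrightarrow> 0 \<le> x i" using x by auto
  define S where "S = sum x V"
  have S: "real m * M \<le> S - M" using Suc.prems by (simp add: algebra_simps S_def)
  have IH: "(S - real m * M) ^ m / fact m \<le> elem_sym m V x"
    using Suc.IH S M by (simp add: S_def)
  \<comment> \<open>The factors of the natural product bound are all replaced by the smallest one,
    which gives a pure power; hence the base may be raised here to fit the induction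
    hypothesis.\<close>
  have "(S - real (Suc m) * M) ^ Suc m / fact m \<le> (S - real m * M) * ((S - real m * M) ^ m / fact m)"
  proof -
    have "(S - real (Suc m) * M) ^ Suc m \<le> (S - real m * M) ^ Suc m"
      using S M by (intro power_mono) (auto simp: algebra_simps)
    then show ?thesis by (simp add: divide_right_mono)
  qed
  also have "\<dots> \<le> (S - real m * M) * elem_sym m V x"
    using IH S M by (intro mult_left_mono) auto
  also have "\<dots> = (\<Sum>I\<in>ksubsets V m. (\<Prod>i\<in>I. x i) * (S - real m * M))"
    unfolding weighted_sum_def sum_distrib_left by (simp add: mult.commute)
  also have "\<dots> \<le> (\<Sum>I\<in>ksubsets V m. (\<Prod>i\<in>I. x i) * sum x (V - I))"
  proof (intro sum_mono mult_left_mono)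
    fix I assume I: "I \<in> ksubsets V m"
    then have "sum x I \<le> real m * M"
      using sum_bounded_above[of I x M] x by (auto simp: ksubsets_def)
    moreover have "sum x (V - I) = S - sum x I"
      using I V by (auto simp: ksubsets_def S_def sum_diff)
    ultimately show "S - real m * M \<le> sum x (V - I)" by simp
    show "0 \<le> (\<Prod>i\<in>I. x i)" using prod_ksubset_nonneg[OF x0 I] .
  qed
  also have "\<dots> = real (Suc m) * elem_sym (Suc m) V x"
    by (rule elem_sym_Suc[OF V, symmetric])
  finally have "(S - real (Suc m) * M) ^ Suc m / fact m / real (Suc m)
      \<le> real (Suc m) * elem_sym (Suc m) V x / real (Suc m)"
    by (intro divide_right_mono) auto
  moreover have "(S - real (Suc m) * M) ^ Suc m / fact m / real (Suc m)
      = (S - real (Suc m) * M) ^ Suc m / fact (Suc m)"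
    by (simp add: mult_ac del: of_nat_Suc)
  moreover have "real (Suc m) * elem_sym (Suc m) V x / real (Suc m) = elem_sym (Suc m) V x"
    by (simp del: of_nat_Suc)
  ultimately show ?case
    unfolding S_def by (simp only:)
qed

text \<open>The error factor is harmless as long as no single weight is a positive proportion of the total.\<close>
lemma weighted_sum_le_local_density:
  assumes V: "finite V" and sk: "s \<le> k"
    and x: "\<And>i. i \<in> V \<Longrightarrow> 0 \<le> x i \<and> x i \<le> M" and M: "0 \<le> M"
    and S: "real k * M \<le> sum x V"
    and g: "\<And>I. I \<in> ksubsets V s \<Longrightarrow> 0 \<le> g I"
    and b: "\<And>K. K \<in> ksubsets V k \<Longrightarrow> (\<Sum>I\<in>ksubsets K s. g I) \<le> b" "0 \<le> b"
  shows "fact s * weighted_sum s g V x * (sum x V - real k * M) ^ (k - s)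
       \<le> b / real (k choose s) * sum x V ^ k"
proof -
  have x0: "\<And>i. i \<in> V \<Longrightarrow> 0 \<le> x i" using x by auto
  have "weighted_sum s g V x * ((sum x V - real k * M) ^ (k - s) / fact (k - s))
      = (\<Sum>I\<in>ksubsets V s. g I * (\<Prod>i\<in>I. x i) * ((sum x V - real k * M) ^ (k - s) / fact (k - s)))"
    by (simp only: weighted_sum_def sum_distrib_right)
  also have "\<dots> \<le> (\<Sum>I\<in>ksubsets V s. g I * (\<Prod>i\<in>I. x i) * elem_sym (k - s) (V - I) x)"
  proof (intro sum_mono mult_left_mono)
    fix I assume I: "I \<in> ksubsets V s"
    show "0 \<le> g I * (\<Prod>i\<in>I. x i)" using g[OF I] prod_ksubset_nonneg[OF x0 I] by simp
    have "sum x I \<le> real s * M"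
      using sum_bounded_above[of I x M] x I by (auto simp: ksubsets_def)
    moreover have "sum x (V - I) = sum x V - sum x I"
      using I V by (auto simp: ksubsets_def sum_diff)
    moreover have "real (k - s) * M = real k * M - real s * M"
      using sk by (simp add: of_nat_diff algebra_simps)
    \<comment> \<open>Removing I costs at most s M and \<open>elem_sym_ge\<close> on the rest costs
      (k - s) M; together this is k M, uniformly in I.\<close>
    ultimately have *: "sum x V - real k * M \<le> sum x (V - I) - real (k - s) * M" by simp
    have "(sum x V - real k * M) ^ (k - s) / fact (k - s)
       \<le> (sum x (V - I) - real (k - s) * M) ^ (k - s) / fact (k - s)"
      using * S by (intro divide_right_mono power_mono) auto
    also have "\<dots> \<le> elem_sym (k - s) (V - I) x"
      using * S V x M by (intro elem_sym_ge) auto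
    finally show "(sum x V - real k * M) ^ (k - s) / fact (k - s) \<le> elem_sym (k - s) (V - I) x" .
  qed
  also have "\<dots> = (\<Sum>K\<in>ksubsets V k. (\<Sum>I\<in>ksubsets K s. g I) * (\<Prod>i\<in>K. x i))"
    by (rule weighted_sum_average[OF V sk, symmetric])
  also have "\<dots> \<le> (\<Sum>K\<in>ksubsets V k. b * (\<Prod>i\<in>K. x i))"
    using b prod_ksubset_nonneg[OF x0] by (intro sum_mono mult_right_mono) auto
  also have "\<dots> = b * elem_sym k V x"
    by (simp add: weighted_sum_def sum_distrib_left)
  also have "\<dots> \<le> b * (sum x V ^ k / fact k)"
    using b elem_sym_le[OF V x0] by (intro mult_left_mono) auto
  finally have "weighted_sum s g V x * (sum x V - real k * M) ^ (k - s) / fact (k - s)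
      \<le> b * sum x V ^ k / fact k" by simp
  then have "fact s * fact (k - s) * (weighted_sum s g V x * (sum x V - real k * M) ^ (k - s) / fact (k - s))
      \<le> fact s * fact (k - s) * (b * sum x V ^ k / fact k)"
    by (intro mult_left_mono) auto
  moreover have "fact s * fact (k - s) * (weighted_sum s g V x * (sum x V - real k * M) ^ (k - s) / fact (k - s))
      = fact s * weighted_sum s g V x * (sum x V - real k * M) ^ (k - s)"
    by simp
  moreover have "fact s * fact (k - s) * (b * sum x V ^ k / fact k) = b / real (k choose s) * sum x V ^ k"
    using sk by (simp add: binomial_fact)
  ultimately show ?thesis by linarith
qed

lemma weighted_sum_mono:
  assumes x: "\<And>i. i \<in> V \<Longrightarrow> 0 \<le> x i"
    and g: "\<And>I. I \<in> ksubsets V k \<Longrightarrow> g I \<le> h I"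
  shows "weighted_sum k g V x \<le> weighted_sum k h V x"
  unfolding weighted_sum_def
  using g prod_ksubset_nonneg[OF x] by (intro sum_mono mult_right_mono) auto

lemma weighted_sum_const: "weighted_sum k (\<lambda>_. c) V x = c * elem_sym k V x"
  by (simp add: weighted_sum_def sum_distrib_left)

lemma weighted_sum_nonneg:
  assumes x: "\<And>i. i \<in> V \<Longrightarrow> 0 \<le> x i"
    and g: "\<And>I. I \<in> ksubsets V k \<Longrightarrow> 0 \<le> g I"
  shows "0 \<le> weighted_sum k g V x"
  unfolding weighted_sum_def
  using g prod_ksubset_nonneg[OF x] by (intro sum_nonneg mult_nonneg_nonneg) auto

lemma weighted_sum_cong:
  assumes "\<And>i. i \<in> V \<Longrightarrow> x i = y i" "\<And>I. I \<in> ksubsets V k \<Longrightarrow> g I = h I"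
  shows "weighted_sum k g V x = weighted_sum k h V y"
  unfolding weighted_sum_def
proof (intro sum.cong refl)
  fix I assume I: "I \<in> ksubsets V k"
  have "(\<Prod>i\<in>I. x i) = (\<Prod>i\<in>I. y i)"
    using I assms(1) by (intro prod.cong) (auto simp: ksubsets_def)
  then show "g I * (\<Prod>i\<in>I. x i) = h I * (\<Prod>i\<in>I. y i)"
    using assms(2)[OF I] by simp
qed

lemma weighted_sum_scale: "weighted_sum k g V (\<lambda>i. c * x i) = c ^ k * weighted_sum k g V x"
proof -
  have "(\<Prod>i\<in>I. c * x i) = c ^ k * (\<Prod>i\<in>I. x i)" if "I \<in> ksubsets V k" for I
    using that by (auto simp: ksubsets_def prod.distrib)
  then show ?thesis
    by (simp add: weighted_sum_def sum_distrib_left mult.left_commute cong: sum.cong)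
qed

lemma bij_betw_insert_ksubsets:
  assumes V: "finite V" and u: "u \<in> V" and k: "0 < k"
  shows "bij_betw (insert u) (ksubsets (V - {u}) (k - 1)) {I \<in> ksubsets V k. u \<in> I}"
proof (rule bij_betw_byWitness[where f' = "\<lambda>I. I - {u}"])
  have fin: "finite J" if "J \<subseteq> V" for J using V that finite_subset by blast
  show "insert u ` ksubsets (V - {u}) (k - 1) \<subseteq> {I \<in> ksubsets V k. u \<in> I}"
  proof
    fix I assume "I \<in> insert u ` ksubsets (V - {u}) (k - 1)"
    then obtain J where J: "I = insert u J" "J \<subseteq> V - {u}" "card J = k - 1"
      by (auto simp: ksubsets_def)
    then have "finite J" "u \<notin> J" using fin by auto
    then show "I \<in> {I \<in> ksubsets V k. u \<in> I}"
      using J u k by (auto simp: ksubsets_def)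
  qed
  show "(\<lambda>I. I - {u}) ` {I \<in> ksubsets V k. u \<in> I} \<subseteq> ksubsets (V - {u}) (k - 1)"
    using fin by (auto simp: ksubsets_def)
qed (auto simp: ksubsets_def)

text \<open>The polynomial is linear in each variable. The coefficient of \<open>x u\<close>, the
  partial derivative, is the polynomial of the link of u.\<close>

lemma weighted_sum_split:
  assumes V: "finite V" and u: "u \<in> V" and k: "0 < k"
  shows "weighted_sum k g V x
       = weighted_sum k g (V - {u}) x + x u * weighted_sum (k - 1) (\<lambda>J. g (insert u J)) (V - {u}) x"
proof -
  have un: "ksubsets V k = ksubsets (V - {u}) k \<union> {I \<in> ksubsets V k. u \<in> I}"
    by (auto simp: ksubsets_def)
  have "(\<Sum>I\<in>ksubsets (V - {u}) k \<union> {I \<in> ksubsets V k. u \<in> I}. g I * (\<Prod>i\<in>I. x i))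
      = weighted_sum k g (V - {u}) x + (\<Sum>I\<in>{I \<in> ksubsets V k. u \<in> I}. g I * (\<Prod>i\<in>I. x i))"
    unfolding weighted_sum_def using V by (intro sum.union_disjoint) (auto simp: ksubsets_def)
  then have "weighted_sum k g V x = weighted_sum k g (V - {u}) x
      + (\<Sum>I\<in>{I \<in> ksubsets V k. u \<in> I}. g I * (\<Prod>i\<in>I. x i))"
    by (simp only: un[symmetric] weighted_sum_def)
  also have "(\<Sum>I\<in>{I \<in> ksubsets V k. u \<in> I}. g I * (\<Prod>i\<in>I. x i))
      = (\<Sum>J\<in>ksubsets (V - {u}) (k - 1). g (insert u J) * (\<Prod>i\<in>insert u J. x i))"
    by (rule sum.reindex_bij_betw[OF bij_betw_insert_ksubsets[OF assms], symmetric])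
  also have "\<dots> = x u * weighted_sum (k - 1) (\<lambda>J. g (insert u J)) (V - {u}) x"
    unfolding weighted_sum_def sum_distrib_left
  proof (intro sum.cong refl)
    fix J assume J: "J \<in> ksubsets (V - {u}) (k - 1)"
    then have "finite J" "u \<notin> J"
      using V finite_in_ksubsets[OF _ J] by (auto simp: ksubsets_def)
    then show "g (insert u J) * (\<Prod>i\<in>insert u J. x i) = x u * (g (insert u J) * (\<Prod>i\<in>J. x i))"
      by simp
  qed
  finally show ?thesis .
qed

section \<open>Copies in hypergraphs\<close>

text \<open>\<open>Ffree_n\<close> fixes the vertex set {0..<n}, while induced subgraphs and the
  graphs of the theorem have arbitrary vertex sets; relabelling mediates between the two.\<close>

definition relabel :: "(nat \<Rightarrow> nat) \<Rightarrow> hg \<Rightarrow> hg" where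
  "relabel f H = (f ` fst H, (`) f ` snd H)"

lemma finite_subgraphs:
  assumes "finite (fst H)" "snd H \<subseteq> Pow (fst H)"
  shows "finite (subgraphs H)"
proof (rule finite_subset)
  show "subgraphs H \<subseteq> Pow (fst H) \<times> Pow (snd H)"
    by (auto simp: subgraphs_def)
  show "finite (Pow (fst H) \<times> Pow (snd H))"
    using assms(1) finite_subset[OF assms(2)] by simp
qed

lemma is_rgraphD:
  assumes "is_rgraph r H"
  shows "finite (fst H)" "snd H \<subseteq> Pow (fst H)"
  using assms by (auto simp: is_rgraph_def)

lemma fst_induced [simp]: "fst (induced H I) = I"
  by (simp add: induced_def)

lemma snd_induced_subset: "snd (induced H I) \<subseteq> Pow I"
  by (auto simp: induced_def)

lemma induced_induced: "I \<subseteq> K \<Longrightarrow> induced (induced H K) I = induced H I"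
  by (auto simp: induced_def)

lemma subgraphs_induced_subset: "I \<subseteq> fst H \<Longrightarrow> subgraphs (induced H I) \<subseteq> subgraphs H"
  by (auto simp: subgraphs_def induced_def)

lemma card_fst_hg_iso: "hg_iso Q G \<Longrightarrow> card (fst G) = card (fst Q)"
  unfolding hg_iso_def using bij_betw_same_card by metis

lemma fst_copy_in_induced:
  assumes "finite I" "card I = card (fst Q)" "G \<in> subgraphs (induced H I)" "hg_iso Q G"
  shows "fst G = I"
proof -
  have "card (fst G) = card I"
    using assms card_fst_hg_iso by metis
  moreover have "fst G \<subseteq> I"
    using assms(3) by (auto simp: subgraphs_def induced_def)
  ultimately show ?thesis
    using card_subset_eq[OF assms(1)] by blast
qed

text \<open>A copy on s vertices spans all of I. Fixing the bijection g of one copy, any other copy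
  with bijection f is the image of that reference under the permutation f o g^-1 of I, so there are
  at most s! of them.\<close>

lemma num_copies_induced_le_fact:
  assumes Q: "snd Q \<subseteq> Pow (fst Q)" and I: "finite I" "card I = card (fst Q)"
  shows "num_copies Q (induced H I) \<le> fact (card (fst Q))"
proof (cases "{G \<in> subgraphs (induced H I). hg_iso Q G} = {}")
  case True
  then show ?thesis unfolding num_copies_def by (simp only: card.empty)
next
  case False
  then obtain g where g: "bij_betw g (fst Q) I"
    using fst_copy_in_induced[OF I] unfolding hg_iso_def by blast
  let ?P = "{\<pi>. \<pi> permutes I}"
  let ?R = "\<lambda>\<pi>. (I, (\<lambda>e. (\<lambda>v. \<pi> (g v)) ` e) ` snd Q)"
  have "{G \<in> subgraphs (induced H I). hg_iso Q G} \<subseteq> ?R ` ?P"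
  proof
    fix G assume G: "G \<in> {G \<in> subgraphs (induced H I). hg_iso Q G}"
    then have "fst G = I" using fst_copy_in_induced[OF I] by blast
    then obtain f where f: "bij_betw f (fst Q) I" "(\<lambda>e. f ` e) ` snd Q = snd G"
      using G by (auto simp: hg_iso_def)
    define h where "h = inv_into (fst Q) g"
    define \<pi> where "\<pi> = (\<lambda>v. if v \<in> I then f (h v) else v)"
    have "bij_betw (f \<circ> h) I I"
      using bij_betw_trans[OF bij_betw_inv_into[OF g] f(1)] by (simp add: h_def)
    then have "bij_betw \<pi> I I"
      by (rule bij_betw_cong[THEN iffD1, rotated]) (simp add: \<pi>_def)
    then have "\<pi> permutes I"
      by (rule bij_imp_permutes) (simp add: \<pi>_def)
    moreover have "\<pi> (g v) = f v" if "v \<in> fst Q" for v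
    proof -
      have "g v \<in> I" using g that by (auto simp: bij_betw_def)
      moreover have "h (g v) = v"
        using g that by (simp add: h_def bij_betw_def)
      ultimately show ?thesis by (simp add: \<pi>_def)
    qed
    then have "(\<lambda>v. \<pi> (g v)) ` e = f ` e" if "e \<in> snd Q" for e
      using Q that by (intro image_cong) auto
    then have "(\<lambda>e. (\<lambda>v. \<pi> (g v)) ` e) ` snd Q = (\<lambda>e. f ` e) ` snd Q"
      by (rule image_cong[OF refl])
    then have "G = ?R \<pi>" using f(2) \<open>fst G = I\<close> by (simp add: prod_eq_iff)
    ultimately show "G \<in> ?R ` ?P" by blast
  qed
  then have "num_copies Q (induced H I) \<le> card ?P"
    unfolding num_copies_def by (rule surj_card_le[OF finite_permutations[OF I(1)]])
  then show ?thesis using card_permutations[OF I(2) I(1)] by simp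
qed

text \<open>Copies are sorted by their vertex sets, which have exactly \<open>card (fst Q)\<close>
  elements.\<close>

lemma num_copies_eq_sum_induced:
  assumes H: "finite (fst H)" "snd H \<subseteq> Pow (fst H)"
  shows "num_copies Q H = (\<Sum>I\<in>ksubsets (fst H) (card (fst Q)). num_copies Q (induced H I))"
proof -
  let ?C = "\<lambda>I. {G \<in> subgraphs (induced H I). hg_iso Q G}"
  let ?K = "ksubsets (fst H) (card (fst Q))"
  have K: "finite I" "card I = card (fst Q)" "I \<subseteq> fst H" if "I \<in> ?K" for I
    using that finite_in_ksubsets[OF H(1) that] by (auto simp: ksubsets_def)
  have "{G \<in> subgraphs H. hg_iso Q G} = (\<Union>I\<in>?K. ?C I)"
  proof (intro equalityI subsetI)
    fix G assume G: "G \<in> {G \<in> subgraphs H. hg_iso Q G}"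
    then have "card (fst G) = card (fst Q)"
      using card_fst_hg_iso by blast
    moreover have "fst G \<subseteq> fst H" "G \<in> subgraphs (induced H (fst G))"
      using G by (auto simp: subgraphs_def induced_def)
    ultimately show "G \<in> (\<Union>I\<in>?K. ?C I)"
      using G by (auto simp: ksubsets_def)
  next
    fix G assume "G \<in> (\<Union>I\<in>?K. ?C I)"
    then obtain I where I: "I \<in> ?K" "G \<in> ?C I" by blast
    then show "G \<in> {G \<in> subgraphs H. hg_iso Q G}"
      using subgraphs_induced_subset[OF K(3)[OF I(1)]] by blast
  qed
  moreover have "card (\<Union>I\<in>?K. ?C I) = (\<Sum>I\<in>?K. card (?C I))"
  proof (rule card_UN_disjoint)
    show "finite ?K" using H by simp
    show "\<forall>I\<in>?K. finite (?C I)"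
    proof
      fix I assume "I \<in> ?K"
      then have "finite (subgraphs (induced H I))"
        using K(1) snd_induced_subset by (intro finite_subgraphs) simp_all
      then show "finite (?C I)" by simp
    qed
    show "\<forall>I\<in>?K. \<forall>J\<in>?K. I \<noteq> J \<longrightarrow> ?C I \<inter> ?C J = {}"
    proof (intro ballI impI)
      fix I J assume IJ: "I \<in> ?K" "J \<in> ?K" "I \<noteq> J"
      have "fst G = I" "fst G = J" if "G \<in> ?C I \<inter> ?C J" for G
        using that fst_copy_in_induced[OF K(1,2)[OF IJ(1)], where H = H]
          fst_copy_in_induced[OF K(1,2)[OF IJ(2)], where H = H] by blast+
      then show "?C I \<inter> ?C J = {}" using IJ(3) by blast
    qed
  qed
  ultimately show ?thesis by (simp add: num_copies_def)
qed

section \<open>Invariance under relabelling of the vertices\<close>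

lemma hg_iso_relabel:
  assumes "hg_iso Q G" "inj_on f (fst G)"
  shows "hg_iso Q (relabel f G)"
proof -
  obtain g where g: "bij_betw g (fst Q) (fst G)" "(\<lambda>e. g ` e) ` snd Q = snd G"
    using assms(1) by (auto simp: hg_iso_def)
  have "bij_betw (f \<circ> g) (fst Q) (fst (relabel f G))"
    using bij_betw_trans[OF g(1) inj_on_imp_bij_betw[OF assms(2)]] by (simp add: relabel_def)
  moreover have "(\<lambda>e. (f \<circ> g) ` e) ` snd Q = snd (relabel f G)"
    unfolding relabel_def snd_conv g(2)[symmetric] by (simp add: image_image image_comp)
  ultimately show ?thesis unfolding hg_iso_def by blast
qed

lemma subgraphs_relabel: "G \<in> subgraphs H \<Longrightarrow> relabel f G \<in> subgraphs (relabel f H)"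
  unfolding subgraphs_def relabel_def by (simp add: image_mono)

lemma relabel_inverse:
  assumes "snd H \<subseteq> Pow (fst H)" "\<And>v. v \<in> fst H \<Longrightarrow> g (f v) = v"
  shows "relabel g (relabel f H) = H"
proof -
  have *: "g ` f ` A = A" if "A \<subseteq> fst H" for A
  proof -
    have "(\<lambda>v. g (f v)) ` A = (\<lambda>v. v) ` A"
      using that assms(2) by (intro image_cong) auto
    then show ?thesis by (simp add: image_image)
  qed
  have "(`) g ` (`) f ` snd H = snd H"
  proof -
    have "(\<lambda>e. g ` f ` e) ` snd H = (\<lambda>e. e) ` snd H"
      using * assms(1) by (intro image_cong) auto
    then show ?thesis by (simp only: image_image image_ident)
  qed
  then show ?thesis using * by (simp add: relabel_def prod_eq_iff)
qed

lemma inj_on_relabel: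
  assumes "snd H \<subseteq> Pow (fst H)" "inj_on f (fst H)"
  shows "inj_on (relabel f) (subgraphs H)"
proof (rule inj_on_inverseI)
  fix G assume G: "G \<in> subgraphs H"
  show "relabel (inv_into (fst H) f) (relabel f G) = G"
    using G assms(2) by (intro relabel_inverse) (auto simp: subgraphs_def)
qed

text \<open>Relabelling maps copies injectively to copies. An inequality suffices to compare any
  graph with a maximum over \<open>Ffree_n\<close>.\<close>

lemma num_copies_relabel_le:
  assumes H: "finite (fst H)" "snd H \<subseteq> Pow (fst H)" and f: "inj_on f (fst H)"
  shows "num_copies Q H \<le> num_copies Q (relabel f H)"
  unfolding num_copies_def
proof (rule card_inj_on_le[where f = "relabel f"])
  show "inj_on (relabel f) {G \<in> subgraphs H. hg_iso Q G}"
    using inj_on_relabel[OF H(2) f] by (rule inj_on_subset) auto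
  show "relabel f ` {G \<in> subgraphs H. hg_iso Q G} \<subseteq> {G \<in> subgraphs (relabel f H). hg_iso Q G}"
  proof (rule image_subsetI)
    fix G assume G: "G \<in> {G \<in> subgraphs H. hg_iso Q G}"
    then have "inj_on f (fst G)"
      using inj_on_subset[OF f] by (simp add: subgraphs_def)
    then show "relabel f G \<in> {G \<in> subgraphs (relabel f H). hg_iso Q G}"
      using G subgraphs_relabel hg_iso_relabel by simp
  qed
  have "finite (subgraphs (relabel f H))"
    using H by (intro finite_subgraphs) (auto simp: relabel_def)
  then show "finite {G \<in> subgraphs (relabel f H). hg_iso Q G}" by simp
qed

lemma induced_relabel:
  assumes "snd H \<subseteq> Pow (fst H)" "inj_on f (fst H)" "I \<subseteq> fst H"
  shows "induced (relabel f H) (f ` I) = relabel f (induced H I)"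
proof -
  have "f ` e \<subseteq> f ` I \<longleftrightarrow> e \<subseteq> I" if "e \<in> snd H" for e
    using assms that by (intro inj_on_image_subset_iff) auto
  then show ?thesis by (auto simp: induced_def relabel_def)
qed

text \<open>A forbidden subgraph of the relabelled graph is pulled back along the inverse of
  f.\<close>

lemma F_free_relabel:
  assumes H: "snd H \<subseteq> Pow (fst H)" and f: "inj_on f (fst H)" and free: "F_free \<F> H"
  shows "F_free \<F> (relabel f H)"
  unfolding F_free_def
proof (intro ballI notI)
  fix F assume F: "F \<in> \<F>" and "\<exists>G\<in>subgraphs (relabel f H). hg_iso F G"
  then obtain G where G: "G \<in> subgraphs (relabel f H)" "hg_iso F G" by blast
  define g where "g = inv_into (fst H) f"
  have "relabel g (relabel f H) = H"
    using H f by (intro relabel_inverse) (auto simp: g_def)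
  then have "relabel g G \<in> subgraphs H"
    using subgraphs_relabel[OF G(1), of g] by simp
  moreover have "inj_on g (fst G)"
    using G(1) inj_on_inv_into[of "fst G" f "fst H"] by (auto simp: g_def subgraphs_def relabel_def)
  then have "hg_iso F (relabel g G)" using hg_iso_relabel G(2) by blast
  ultimately show False using free F by (auto simp: F_free_def)
qed

lemma is_rgraph_relabel:
  assumes "is_rgraph r H" "inj_on f (fst H)"
  shows "is_rgraph r (relabel f H)"
proof -
  have "card (f ` e) = card e" if "e \<in> snd H" for e
    using assms that inj_on_subset[OF assms(2)] by (intro card_image) (simp add: is_rgraph_def)
  then show ?thesis using assms(1) by (auto simp: is_rgraph_def relabel_def)
qed

lemma is_rgraph_induced: "is_rgraph r H \<Longrightarrow> I \<subseteq> fst H \<Longrightarrow> is_rgraph r (induced H I)"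
  using finite_subset[of I "fst H"] by (auto simp: is_rgraph_def induced_def)

lemma F_free_induced: "F_free \<F> H \<Longrightarrow> I \<subseteq> fst H \<Longrightarrow> F_free \<F> (induced H I)"
  using subgraphs_induced_subset unfolding F_free_def by blast

lemma relabel_in_Ffree_n:
  assumes H: "is_rgraph r H" "F_free \<F> H" "card (fst H) = n"
  obtains f where "inj_on f (fst H)" "relabel f H \<in> Ffree_n r \<F> n"
proof -
  obtain f where f: "bij_betw f (fst H) {0..<n}"
    using ex_bij_betw_finite_nat[of "fst H"] H is_rgraphD by blast
  then have "inj_on f (fst H)" "f ` fst H = {0..<n}" by (auto simp: bij_betw_def)
  moreover from this have "relabel f H \<in> Ffree_n r \<F> n"
    using H is_rgraph_relabel[OF H(1)] F_free_relabel[OF is_rgraphD(2)[OF H(1)]]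
    by (simp add: Ffree_n_def) (simp add: relabel_def)
  ultimately show ?thesis using that by blast
qed

lemma finite_Ffree_n: "finite (Ffree_n r \<F> n)"
proof (rule finite_subset)
  show "Ffree_n r \<F> n \<subseteq> {{0..<n}} \<times> Pow (Pow {0..<n})"
    by (force simp: Ffree_n_def is_rgraph_def)
qed simp

lemma num_copies_le_ex_num:
  assumes H: "is_rgraph r H" "F_free \<F> H" "card (fst H) = n"
  shows "num_copies Q H \<le> ex_num r Q \<F> n"
proof -
  obtain f where f: "inj_on f (fst H)" "relabel f H \<in> Ffree_n r \<F> n"
    using relabel_in_Ffree_n[OF H] by blast
  have "num_copies Q H \<le> num_copies Q (relabel f H)"
    using num_copies_relabel_le is_rgraphD[OF H(1)] f(1) by blast
  also have "\<dots> \<le> ex_num r Q \<F> n"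
    unfolding ex_num_def using f(2) finite_Ffree_n by (intro Max_ge) auto
  finally show ?thesis .
qed

lemma ex_num_attained:
  assumes "Ffree_n r \<F> n \<noteq> {}"
  obtains H where "H \<in> Ffree_n r \<F> n" "num_copies Q H = ex_num r Q \<F> n"
proof -
  have "ex_num r Q \<F> n \<in> num_copies Q ` Ffree_n r \<F> n"
    unfolding ex_num_def using assms finite_Ffree_n by (intro Max_in) auto
  then show ?thesis using that by force
qed

text \<open>The edgeless graph is free: a member of the family inside it has no edges, hence,
  without isolated vertices, no vertices either.\<close>

lemma Ffree_n_nonempty:
  assumes "\<forall>F\<in>\<F>. no_isolated F" "({}, {}) \<notin> \<F>"
  shows "Ffree_n r \<F> n \<noteq> {}"
proof -
  have "F_free \<F> ({0..<n}, {})"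
    unfolding F_free_def
  proof (intro ballI notI)
    fix F assume F: "F \<in> \<F>" and "\<exists>G\<in>subgraphs ({0..<n}, {}). hg_iso F G"
    then have "snd F = {}" by (auto simp: subgraphs_def hg_iso_def)
    then have "F = ({}, {})"
      using assms(1) F by (auto simp: no_isolated_def prod_eq_iff)
    then show False using assms(2) F by simp
  qed
  then show ?thesis by (auto simp: Ffree_n_def is_rgraph_def)
qed

lemma not_F_free_if_empty_mem: "({}, {}) \<in> \<F> \<Longrightarrow> \<not> F_free \<F> H"
proof -
  assume "({}, {}) \<in> \<F>"
  moreover have "({}, {}) \<in> subgraphs H" "hg_iso ({}, {}) ({}, {})"
    by (auto simp: subgraphs_def hg_iso_def)
  ultimately show ?thesis unfolding F_free_def by blast
qed

section \<open>The spectral parameter\<close>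

text \<open>Compactness: a continuous function attains its maximum on the nonnegative part of the
  unit sphere.\<close>

lemma weighted_sum_max:
  fixes V :: "'a set"
  assumes V: "finite V" "V \<noteq> {}" and p: "0 < p"
  obtains x where "\<And>i. 0 \<le> x i" "(\<Sum>i\<in>V. x i powr p) = 1"
    "\<And>y. (\<And>i. i \<in> V \<Longrightarrow> 0 \<le> y i) \<Longrightarrow> (\<Sum>i\<in>V. y i powr p) = 1
       \<Longrightarrow> weighted_sum k g V y \<le> weighted_sum k g V x"
proof -
  \<comment> \<open>Vectors are functions on the whole type. Freezing the coordinates outside V at 0
    makes the box a product of compact sets.\<close>
  define B where "B = Pi\<^sub>E UNIV (\<lambda>i. if i \<in> V then {0..1::real} else {0})"
  define K where "K = B \<inter> {x. (\<Sum>i\<in>V. x i powr p) = 1}"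
  have B: "B \<subseteq> {x. \<forall>i. 0 \<le> x i}"
  proof clarify
    fix x i assume "x \<in> B"
    then have "x i \<in> (if i \<in> V then {0..1} else {0})" by (simp add: B_def PiE_iff)
    then show "0 \<le> x i" by (simp split: if_splits)
  qed
  have "compactin (product_topology (\<lambda>i. euclidean) UNIV) B"
    unfolding B_def by (auto simp: compactin_PiE)
  then have "compact B"
    by (simp add: euclidean_product_topology)
  have coord: "continuous_on S (\<lambda>x :: 'a \<Rightarrow> real. x i)" for S i
    using continuous_on_product_coordinates by (rule continuous_on_subset) auto
  \<comment> \<open>With absolute values the constraint is continuous on the whole space, so it cuts
    out a closed set; on B it agrees with the original one.\<close>
  have "continuous_on UNIV (\<lambda>x. \<Sum>i\<in>V. \<bar>x i\<bar> powr p)"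
    using p by (intro continuous_on_sum continuous_on_powr' continuous_on_rabs coord continuous_on_const) auto
  then have "closed {x. (\<Sum>i\<in>V. \<bar>x i\<bar> powr p) = 1}"
    by (intro closed_Collect_eq continuous_on_const)
  moreover have "K = B \<inter> {x. (\<Sum>i\<in>V. \<bar>x i\<bar> powr p) = 1}"
    using B by (auto simp: K_def)
  ultimately have "compact K"
    using compact_Int_closed[OF \<open>compact B\<close>] by simp
  obtain v where v: "v \<in> V" using V by blast
  have "(\<lambda>i. if i = v then 1 else 0) \<in> K"
  proof -
    have "(\<Sum>i\<in>V. (if i = v then 1 else 0) powr p) = (\<Sum>i\<in>V. if i = v then 1 else 0)"
      by (intro sum.cong) auto
    then show ?thesis using v V by (auto simp: K_def B_def PiE_iff)
  qed
  then have "K \<noteq> {}" by blast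
  have "continuous_on K (weighted_sum k g V)"
    unfolding weighted_sum_def
    by (intro continuous_on_sum continuous_on_mult continuous_on_prod coord continuous_on_const)
  then obtain x where x: "x \<in> K" "\<forall>y\<in>K. weighted_sum k g V y \<le> weighted_sum k g V x"
    using continuous_attains_sup[OF \<open>compact K\<close> \<open>K \<noteq> {}\<close>] by blast
  show ?thesis
  proof (rule that[of x])
    show "0 \<le> x i" for i using x(1) B by (auto simp: K_def)
    show "(\<Sum>i\<in>V. x i powr p) = 1" using x(1) by (simp add: K_def)
    fix y assume y: "\<And>i. i \<in> V \<Longrightarrow> 0 \<le> y i" "(\<Sum>i\<in>V. y i powr p) = 1"
    \<comment> \<open>Cutting y off outside V brings it into K without changing its value.\<close>
    define z where "z = (\<lambda>i. if i \<in> V then y i else 0)"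
    have "z i \<le> 1" if "i \<in> V" for i
    proof (rule ccontr)
      assume "\<not> z i \<le> 1"
      then have "1 < y i powr p" using that p by (simp add: z_def less_powr_iff[symmetric])
      moreover have "y i powr p \<le> (\<Sum>i\<in>V. y i powr p)"
        using V that by (intro member_le_sum) auto
      ultimately show False using y(2) by simp
    qed
    moreover have "(\<Sum>i\<in>V. z i powr p) = 1"
      using y(2) by (simp add: z_def)
    ultimately have "z \<in> K"
      using y(1) by (auto simp: K_def B_def PiE_iff z_def)
    moreover have "weighted_sum k g V y = weighted_sum k g V z"
      by (intro weighted_sum_cong) (auto simp: z_def)
    ultimately show "weighted_sum k g V y \<le> weighted_sum k g V x"
      using x(2) by simp
  qed
qed

lemma Ppoly_eq_weighted_sum:
  "Ppoly Q H x = fact (card (fst Q)) *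
     weighted_sum (card (fst Q)) (\<lambda>I. real (num_copies Q (induced H I))) (fst H) x"
  by (simp add: Ppoly_def weighted_sum_def ksubsets_def)

lemma Ppoly_le_Ppoly_abs: "Ppoly Q H x \<le> Ppoly Q H (\<lambda>i. \<bar>x i\<bar>)"
proof -
  have "(\<Prod>i\<in>I. x i) \<le> (\<Prod>i\<in>I. \<bar>x i\<bar>)" for I
    by (metis abs_ge_self abs_prod)
  then show ?thesis
    unfolding Ppoly_def by (intro mult_left_mono sum_mono) auto
qed

text \<open>\<open>lam\<close> ranges over signed vectors, but the coefficients are nonnegative, so
  passing to absolute values keeps the norm and does not decrease the polynomial.\<close>

lemma lam_attained:
  assumes H: "finite (fst H)" "fst H \<noteq> {}" and p: "0 < p"
  obtains x where "\<And>i. 0 \<le> x i" "(\<Sum>i\<in>fst H. x i powr p) = 1" "lam p Q H = Ppoly Q H x"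
    "\<And>y. (\<And>i. i \<in> fst H \<Longrightarrow> 0 \<le> y i) \<Longrightarrow> (\<Sum>i\<in>fst H. y i powr p) = 1 \<Longrightarrow> Ppoly Q H y \<le> lam p Q H"
proof -
  let ?g = "\<lambda>I. real (num_copies Q (induced H I))"
  obtain x where x: "\<And>i. 0 \<le> x i" "(\<Sum>i\<in>fst H. x i powr p) = 1"
    "\<And>y. (\<And>i. i \<in> fst H \<Longrightarrow> 0 \<le> y i) \<Longrightarrow> (\<Sum>i\<in>fst H. y i powr p) = 1
       \<Longrightarrow> weighted_sum (card (fst Q)) ?g (fst H) y \<le> weighted_sum (card (fst Q)) ?g (fst H) x"
    using weighted_sum_max[OF H p, where k = "card (fst Q)" and g = ?g] by metis
  have max: "Ppoly Q H y \<le> Ppoly Q H x"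
    if "\<And>i. i \<in> fst H \<Longrightarrow> 0 \<le> y i" "(\<Sum>i\<in>fst H. y i powr p) = 1" for y
    using x(3)[OF that] by (simp add: Ppoly_eq_weighted_sum)
  have "lam p Q H = Ppoly Q H x"
    unfolding lam_def
  proof (rule cSup_eq_maximum)
    show "Ppoly Q H x \<in> {Ppoly Q H x | x. (\<Sum>i\<in>fst H. \<bar>x i\<bar> powr p) powr (1/p) = 1}"
      using x(1,2) by (auto intro!: exI[of _ x])
    fix c assume "c \<in> {Ppoly Q H x | x. (\<Sum>i\<in>fst H. \<bar>x i\<bar> powr p) powr (1/p) = 1}"
    then obtain z where z: "c = Ppoly Q H z" "(\<Sum>i\<in>fst H. \<bar>z i\<bar> powr p) powr (1/p) = 1" by blast
    have "(\<Sum>i\<in>fst H. \<bar>z i\<bar> powr p) = ((\<Sum>i\<in>fst H. \<bar>z i\<bar> powr p) powr (1/p)) powr p"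
      using p by (simp add: powr_powr sum_nonneg)
    also have "\<dots> = 1" using z(2) by simp
    finally have "Ppoly Q H (\<lambda>i. \<bar>z i\<bar>) \<le> Ppoly Q H x"
      by (intro max) auto
    then show "c \<le> Ppoly Q H x" using Ppoly_le_Ppoly_abs[of Q H z] z(1) by simp
  qed
  then show ?thesis using that[of x] x(1,2) max by simp
qed

text \<open>Homogeneity of degree s removes the normalisation. This form admits vectors with one
  coordinate changed or one vertex deleted.\<close>

lemma Ppoly_le_lam:
  assumes H: "finite (fst H)" "fst H \<noteq> {}" and p: "0 < p" and Q: "0 < card (fst Q)"
    and y: "\<And>i. i \<in> fst H \<Longrightarrow> 0 \<le> y i"
  shows "Ppoly Q H y \<le> lam p Q H * (\<Sum>i\<in>fst H. y i powr p) powr (real (card (fst Q)) / p)"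
proof -
  define N where "N = (\<Sum>i\<in>fst H. y i powr p)"
  define s where "s = card (fst Q)"
  have "N \<ge> 0" unfolding N_def by (intro sum_nonneg) auto
  show ?thesis
  proof (cases "N = 0")
    \<comment> \<open>The zero vector cannot be normalised; here every product contains a zero
      factor since s > 0, and \<open>0 powr _ = 0\<close>.\<close>
    case True
    then have "\<forall>i\<in>fst H. y i = 0"
      using H unfolding N_def by (subst (asm) sum_nonneg_eq_0_iff) auto
    moreover have "\<exists>i. i \<in> I" "finite I" if "I \<subseteq> fst H \<and> card I = s" for I
      using that Q by (auto simp: s_def card_gt_0_iff intro: ccontr)
    ultimately have "(\<Prod>i\<in>I. y i) = 0" if "I \<in> {I. I \<subseteq> fst H \<and> card I = s}" for I
      using that by (intro prod_zero) blast+
    then have "Ppoly Q H y = 0" by (simp add: Ppoly_def s_def)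
    then show ?thesis using True by (simp add: N_def)
  next
    case False
    then have N: "N > 0" using \<open>N \<ge> 0\<close> by simp
    define c where "c = N powr (- 1 / p)"
    have cp: "c powr p = inverse N"
    proof -
      have "c powr p = N powr (- 1)" using p by (simp only: c_def powr_powr) simp
      then show ?thesis using N by (simp add: powr_minus)
    qed
    have "c > 0" using N by (simp add: c_def)
    obtain x where max: "\<And>y. (\<And>i. i \<in> fst H \<Longrightarrow> 0 \<le> y i) \<Longrightarrow> (\<Sum>i\<in>fst H. y i powr p) = 1
        \<Longrightarrow> Ppoly Q H y \<le> lam p Q H"
      using lam_attained[OF H p] by metis
    have "(\<Sum>i\<in>fst H. (c * y i) powr p) = (\<Sum>i\<in>fst H. inverse N * y i powr p)"
      using y \<open>c > 0\<close> by (intro sum.cong) (auto simp: powr_mult cp)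
    also have "\<dots> = 1" using N by (simp add: N_def sum_distrib_left[symmetric])
    finally have "Ppoly Q H (\<lambda>i. c * y i) \<le> lam p Q H"
      using y \<open>c > 0\<close> by (intro max) auto
    then have "c ^ s * Ppoly Q H y \<le> lam p Q H"
      by (simp add: Ppoly_eq_weighted_sum weighted_sum_scale s_def mult_ac)
    moreover have "c ^ s * N powr (real s / p) = 1"
      using N by (simp add: c_def powr_powr powr_realpow[symmetric] powr_add[symmetric])
    then have "Ppoly Q H y = (c ^ s * Ppoly Q H y) * N powr (real s / p)"
      by (simp add: mult_ac)
    ultimately show ?thesis
      unfolding N_def[symmetric] s_def[symmetric] by (metis mult_right_mono powr_ge_zero)
  qed
qed

lemma ksubsets_image:
  assumes "inj_on f V"
  shows "ksubsets (f ` V) k = (`) f ` ksubsets V k"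
proof -
  have "card (f ` I) = card I" if "I \<subseteq> V" for I
    using card_image[OF inj_on_subset[OF assms that]] .
  then show ?thesis
    unfolding ksubsets_def by (auto simp: subset_image_iff)
qed

lemma lam_relabel_le:
  assumes H: "finite (fst H)" "fst H \<noteq> {}" "snd H \<subseteq> Pow (fst H)" and f: "inj_on f (fst H)" and p: "0 < p"
  shows "lam p Q H \<le> lam p Q (relabel f H)"
proof -
  let ?V = "fst H" and ?s = "card (fst Q)"
  obtain x where x: "\<And>i. 0 \<le> x i" "(\<Sum>i\<in>?V. x i powr p) = 1" "lam p Q H = Ppoly Q H x"
    using lam_attained[OF H(1,2) p] by metis
  define y where "y = (\<lambda>j. x (inv_into ?V f j))"
  have yf: "y (f i) = x i" if "i \<in> ?V" for i
    using f that by (simp add: y_def)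
  have V': "fst (relabel f H) = f ` ?V" by (simp add: relabel_def)
  have "inj_on ((`) f) (ksubsets ?V ?s)"
    using inj_on_image_Pow[OF f] by (rule inj_on_subset) (auto simp: ksubsets_def)
  then have "Ppoly Q (relabel f H) y = fact ?s * (\<Sum>I\<in>ksubsets ?V ?s.
      real (num_copies Q (induced (relabel f H) (f ` I))) * (\<Prod>i\<in>f ` I. y i))"
    unfolding Ppoly_eq_weighted_sum weighted_sum_def V' ksubsets_image[OF f]
    by (simp add: sum.reindex)
  moreover have "Ppoly Q H x \<le> fact ?s * (\<Sum>I\<in>ksubsets ?V ?s.
      real (num_copies Q (induced (relabel f H) (f ` I))) * (\<Prod>i\<in>f ` I. y i))"
    unfolding Ppoly_eq_weighted_sum weighted_sum_def
  proof (intro mult_left_mono sum_mono)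
    fix I assume I: "I \<in> ksubsets ?V ?s"
    then have IV: "I \<subseteq> ?V" "finite I"
      using finite_in_ksubsets[OF H(1) I] by (auto simp: ksubsets_def)
    have "inj_on f I" using inj_on_subset[OF f IV(1)] .
    then have "(\<Prod>i\<in>f ` I. y i) = (\<Prod>i\<in>I. x i)"
      using IV(1) yf by (subst prod.reindex) (auto intro!: prod.cong)
    moreover have "num_copies Q (induced H I) \<le> num_copies Q (induced (relabel f H) (f ` I))"
      unfolding induced_relabel[OF H(3) f IV(1)]
      using IV \<open>inj_on f I\<close> snd_induced_subset by (intro num_copies_relabel_le) simp_all
    ultimately show "real (num_copies Q (induced H I)) * (\<Prod>i\<in>I. x i)
        \<le> real (num_copies Q (induced (relabel f H) (f ` I))) * (\<Prod>i\<in>f ` I. y i)"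
      using x(1) by (simp add: mult_right_mono prod_nonneg)
  qed simp
  moreover have "Ppoly Q (relabel f H) y \<le> lam p Q (relabel f H)"
  proof -
    have "(\<Sum>i\<in>fst (relabel f H). y i powr p) = 1"
      unfolding V' using x(2) yf f by (simp add: sum.reindex)
    moreover have "\<And>i. 0 \<le> y i" using x(1) by (simp add: y_def)
    moreover have "finite (fst (relabel f H))" "fst (relabel f H) \<noteq> {}"
      using H by (simp_all add: V')
    ultimately show ?thesis using lam_attained[of "relabel f H" p Q] p by metis
  qed
  ultimately show ?thesis using x(3) by linarith
qed

text \<open>Relabelling extends the bound from graphs on {0..<n} to all n-vertex vertex
  sets.\<close>

lemma lam_le_lam_class:
  assumes H: "is_rgraph r H" "F_free \<F> H" "card (fst H) = n" and n: "0 < n" and p: "0 < p"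
  shows "lam p Q H \<le> lam_class p Q (Ffree_n r \<F> n)"
proof -
  obtain f where f: "inj_on f (fst H)" "relabel f H \<in> Ffree_n r \<F> n"
    using relabel_in_Ffree_n[OF H] by blast
  have "lam p Q H \<le> lam p Q (relabel f H)"
    using H n p f(1) is_rgraphD[OF H(1)] by (intro lam_relabel_le) auto
  also have "\<dots> \<le> lam_class p Q (Ffree_n r \<F> n)"
    unfolding lam_class_def using f(2) finite_Ffree_n
    by (intro cSup_upper) auto
  finally show ?thesis .
qed

lemma lam_class_attained:
  assumes "Ffree_n r \<F> n \<noteq> {}"
  obtains H where "H \<in> Ffree_n r \<F> n" "lam p Q H = lam_class p Q (Ffree_n r \<F> n)"
proof -
  have "lam_class p Q (Ffree_n r \<F> n) \<in> lam p Q ` Ffree_n r \<F> n"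
    unfolding lam_class_def using assms finite_Ffree_n[of r \<F> n]
    by (subst cSup_eq_Max) auto
  then show ?thesis using that by force
qed

text \<open>This is the Lagrange condition without multipliers: by \<open>Ppoly_le_lam\<close> the
  coordinate u may vary freely, and the slack of that inequality is nonnegative and vanishes at
  \<open>x u\<close>, so its derivative there is 0.\<close>

lemma lagrange_coordinate:
  assumes H: "finite (fst H)" and u: "u \<in> fst H" and p: "1 < p" and Q: "0 < card (fst Q)"
    and x: "\<And>i. 0 \<le> x i" "(\<Sum>i\<in>fst H. x i powr p) = 1" "lam p Q H = Ppoly Q H x"
    and xu: "0 < x u"
  shows "lam p Q H * real (card (fst Q)) * x u powr (p - 1)
       = fact (card (fst Q)) * weighted_sum (card (fst Q) - 1)
           (\<lambda>J. real (num_copies Q (induced H (insert u J)))) (fst H - {u}) x"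
proof -
  define V where "V = fst H"
  define s where "s = card (fst Q)"
  define g where "g = (\<lambda>I. real (num_copies Q (induced H I)))"
  define A where "A = fact s * weighted_sum s g (V - {u}) x"
  define B where "B = fact s * weighted_sum (s - 1) (\<lambda>J. g (insert u J)) (V - {u}) x"
  define R where "R = (\<Sum>i\<in>V - {u}. x i powr p)"
  have R: "R = 1 - x u powr p"
    using sum.remove[of V u "\<lambda>i. x i powr p"] H u x(2) by (simp add: R_def V_def)
  have P: "Ppoly Q H (x(u := z)) = A + z * B" for z
  proof -
    have "Ppoly Q H (x(u := z)) = fact s * (weighted_sum s g (V - {u}) (x(u := z))
        + z * weighted_sum (s - 1) (\<lambda>J. g (insert u J)) (V - {u}) (x(u := z)))"
      unfolding Ppoly_eq_weighted_sum using weighted_sum_split[OF H u Q, of g "x(u := z)"]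
      by (simp add: s_def g_def V_def)
    also have "weighted_sum s g (V - {u}) (x(u := z)) = weighted_sum s g (V - {u}) x"
      by (intro weighted_sum_cong) auto
    also have "weighted_sum (s - 1) (\<lambda>J. g (insert u J)) (V - {u}) (x(u := z))
        = weighted_sum (s - 1) (\<lambda>J. g (insert u J)) (V - {u}) x"
      by (intro weighted_sum_cong) auto
    finally show ?thesis by (simp only: A_def B_def distrib_left mult.left_commute)
  qed
  \<comment> \<open>The slack as a function of the value z at u: R is the contribution of the other
    vertices to the p-th power of the norm, and B is the partial derivative of the polynomial at
    u.\<close>
  define \<phi> where "\<phi> = (\<lambda>z. lam p Q H * (R + z powr p) powr (real s / p) - (A + z * B))"
  have nonneg: "0 \<le> \<phi> z" if "0 \<le> z" for z
  proof -
    have "Ppoly Q H (x(u := z)) \<le> lam p Q H * (\<Sum>i\<in>fst H. (x(u := z)) i powr p) powr (real s / p)"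
      using H u p Q x(1) that unfolding s_def by (intro Ppoly_le_lam) auto
    also have "(\<Sum>i\<in>fst H. (x(u := z)) i powr p) = R + z powr p"
      using sum.remove[of V u "\<lambda>i. (x(u := z)) i powr p"] H u by (simp add: R_def V_def)
    finally show ?thesis unfolding \<phi>_def P by linarith
  qed
  have zero: "\<phi> (x u) = 0"
    using P[of "x u"] x(3) by (simp add: \<phi>_def R)
  have "((\<lambda>z. lam p Q H * (R + z powr p) powr (real s / p) - (A + z * B)) has_real_derivative
      lam p Q H * (real s / p * (R + x u powr p) powr (real s / p - 1) * (p * x u powr (p - 1))) - B) (at (x u))"
    using xu R p by (auto intro!: derivative_eq_intros)
  moreover have "R + x u powr p = 1" by (simp add: R)
  ultimately have "(\<phi> has_real_derivative lam p Q H * real s * x u powr (p - 1) - B) (at (x u))"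
    using p by (simp add: \<phi>_def mult_ac)
  \<comment> \<open>The radius \<open>x u\<close> keeps y positive, where the slack is known to be
    nonnegative.\<close>
  moreover have "\<forall>y. \<bar>x u - y\<bar> < x u \<longrightarrow> \<phi> (x u) \<le> \<phi> y"
    using nonneg zero by (auto simp: abs_if split: if_splits)
  ultimately have "lam p Q H * real s * x u powr (p - 1) - B = 0"
    using DERIV_local_min xu by blast
  then show ?thesis by (simp add: B_def s_def g_def V_def)
qed

lemma Qdeg_eq_sum:
  assumes "finite (fst H)" "u \<in> fst H" "0 < card (fst Q)"
  shows "Qdeg Q H u = (\<Sum>J\<in>ksubsets (fst H - {u}) (card (fst Q) - 1). num_copies Q (induced H (insert u J)))"
proof -
  have "{I. I \<subseteq> fst H \<and> card I = card (fst Q) \<and> u \<in> I} = {I \<in> ksubsets (fst H) (card (fst Q)). u \<in> I}"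
    by (auto simp: ksubsets_def)
  then show ?thesis
    unfolding Qdeg_def using sum.reindex_bij_betw[OF bij_betw_insert_ksubsets[OF assms], symmetric] by simp
qed

section \<open>Asymptotics\<close>

lemma fact_binomial_over_power_tendsto:
  "(\<lambda>n. fact k * real (n choose k) / real n ^ k) \<longlonglongrightarrow> 1"
proof (induction k)
  case 0 then show ?case by simp
next
  case (Suc k)
  have "(\<lambda>n. 1 - real k * (1 / real n)) \<longlonglongrightarrow> 1 - real k * 0"
    by (intro tendsto_intros lim_1_over_n)
  then have "(\<lambda>n. fact k * real (n choose k) / real n ^ k * (1 - real k * (1 / real n))) \<longlonglongrightarrow> 1 * 1"
    using Suc by (intro tendsto_mult) simp_all
  moreover have "\<forall>\<^sub>F n in sequentially.
      fact k * real (n choose k) / real n ^ k * (1 - real k * (1 / real n))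
      = fact (Suc k) * real (n choose Suc k) / real n ^ Suc k"
    using eventually_ge_at_top[of "Suc k"]
  proof eventually_elim
    case (elim n)
    have "Suc k * (n choose Suc k) = (n - k) * (n choose k)"
      using binomial_absorption[of k n] binomial_absorb_comp[of n k] by simp
    then have *: "real (Suc k) * real (n choose Suc k) = (real n - real k) * real (n choose k)"
      using elim by (metis Suc_leD of_nat_diff of_nat_mult)
    have "fact (Suc k) * real (n choose Suc k) / real n ^ Suc k
        = fact k * (real (Suc k) * real (n choose Suc k)) / real n ^ Suc k"
      by (simp add: mult_ac)
    also have "\<dots> = fact k * ((real n - real k) * real (n choose k)) / real n ^ Suc k"
      by (simp only: *)
    also have "\<dots> = fact k * real (n choose k) / real n ^ k * ((real n - real k) / real n)"
      by (simp add: mult_ac)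
    also have "(real n - real k) / real n = 1 - real k * (1 / real n)"
      using elim by (simp add: diff_divide_distrib)
    finally show ?case by simp
  qed
  ultimately show ?case
    by (simp add: tendsto_cong)
qed

text \<open>This is \<open>elem_sym_le\<close> at the all-ones vector.\<close>

lemma binomial_le_power_over_fact: "real (n choose k) \<le> real n ^ k / fact k"
  using elem_sym_le[of "{0..<n}" "\<lambda>_. 1" k] by (simp add: weighted_sum_def card_ksubsets)

section \<open>Inequalities for nearly constant vectors\<close>

text \<open>The power mean inequality, obtained by summing Young's inequality for \<open>y i\<close>
  times 1.\<close>

lemma sum_le_card_if_sum_powr_eq_card:
  fixes y :: "'a \<Rightarrow> real"
  assumes p: "1 < p" and y: "\<And>i. i \<in> V \<Longrightarrow> 0 \<le> y i"
    and S: "(\<Sum>i\<in>V. y i powr p) = real (card V)"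
  shows "sum y V \<le> real (card V)"
proof -
  define q where "q = p / (p - 1)"
  have q: "1 < q" "1 / p + 1 / q = 1" using p by (auto simp: q_def field_simps)
  have "sum y V \<le> (\<Sum>i\<in>V. y i powr p / p + 1 / q)"
  proof (rule sum_mono)
    fix i assume "i \<in> V"
    then show "y i \<le> y i powr p / p + 1 / q"
      using Youngs_inequality[of p q "y i" 1] p q y by simp
  qed
  also have "\<dots> = real (card V) * (1 / p + 1 / q)"
    using S by (simp add: sum.distrib sum_divide_distrib[symmetric] algebra_simps)
  finally show ?thesis using q by simp
qed

text \<open>A vertex of too small weight could be deleted at too small a loss, contradicting
  \<open>growth\<close>. Here t is the weight of the vertex, b = s/p, and L, L' are the spectral
  values before and after the deletion.\<close>

lemma weight_lower_bound:
  fixes n s a b \<pi> \<sigma> t L L' :: real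
  assumes n: "1 \<le> n" "s \<le> n" and b: "0 < b" "b < s" "a = s - b"
    and \<sigma>: "0 < \<sigma>" "\<sigma> < 1/2" and \<pi>: "0 < \<pi>" and t: "0 \<le> t" and L: "0 \<le> L" "L \<le> \<pi> * (1 + \<sigma>) * n powr a"
    and del: "L * (1 - s * t) \<le> L' * (1 - t) powr b"
    and growth: "L' + \<pi> * a * (1 - \<sigma>) * n powr (a - 1) \<le> L"
    and large: "(1 + \<sigma>) * (1 - 2 * \<sigma>) * (a + s * b / n) < a * (1 - \<sigma>)"
  shows "(1 - 2 * \<sigma>) / n \<le> t"
proof (rule ccontr)
  assume "\<not> (1 - 2 * \<sigma>) / n \<le> t"
  then have tn: "t < (1 - 2 * \<sigma>) / n" by simp
  also have "\<dots> < 1 / n" using n \<sigma> by (simp add: divide_strict_right_mono)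
  finally have t1: "t < 1 / n" .
  have st: "s * t \<le> 1"
  proof -
    have "s * t \<le> n * (1 / n)" using n t t1 b by (intro mult_mono) auto
    then show ?thesis using n by simp
  qed
  have "1 / n \<le> 1" using n by simp
  then have "t < 1" using t1 by simp
  define d where "d = (1 - t) powr b"
  have d: "0 < d" using \<open>t < 1\<close> by (simp add: d_def)
  \<comment> \<open>The aim is d (1 + b t) <= 1, which trades the power of 1 - t for a linear
    factor.\<close>
  have "d \<le> exp (- (b * t))"
  proof -
    have "d = exp (b * ln (1 - t))" using \<open>t < 1\<close> by (simp add: d_def powr_def)
    moreover have "b * ln (1 - t) \<le> b * (- t)"
      using ln_le_minus_one[of "1 - t"] \<open>t < 1\<close> b by (intro mult_left_mono) auto
    ultimately show ?thesis by simp
  qed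
  moreover have "1 + b * t \<le> exp (b * t)" by (rule exp_ge_add_one_self)
  moreover have "0 \<le> 1 + b * t" using b t by simp
  ultimately have "d * (1 + b * t) \<le> exp (- (b * t)) * exp (b * t)"
    using d by (intro mult_mono) auto
  then have d1: "d * (1 + b * t) \<le> 1" by (simp add: exp_minus)
  have "0 \<le> L * (1 - s * t)" using L st by simp
  then have "0 \<le> L' * d" using del by (simp add: d_def)
  then have "0 \<le> L'" using d by (simp add: zero_le_mult_iff)
  have "L * (1 - s * t) * (1 + b * t) \<le> L' * d * (1 + b * t)"
    using del b t by (intro mult_right_mono) (auto simp: d_def)
  also have "\<dots> \<le> L'"
    using mult_left_mono[OF d1 \<open>0 \<le> L'\<close>] by (simp add: mult.assoc)
  \<comment> \<open>Since a = s - b, the product (1 - s t)(1 + b t) equals 1 - t (a + s b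
    t).\<close>
  finally have "L - L' \<le> L * (t * (a + s * b * t))"
    unfolding b(3) by (simp add: algebra_simps)
  also have "\<dots> \<le> (\<pi> * (1 + \<sigma>) * n powr a) * ((1 - 2 * \<sigma>) / n * (a + s * b * (1 / n)))"
    using L t tn t1 b \<sigma> \<pi> n by (intro mult_mono add_left_mono) auto
  also have "\<dots> = \<pi> * n powr (a - 1) * ((1 + \<sigma>) * (1 - 2 * \<sigma>) * (a + s * b / n))"
    using n by (simp add: powr_diff)
  also have "\<dots> < \<pi> * n powr (a - 1) * (a * (1 - \<sigma>))"
    using large \<pi> n by (intro mult_strict_left_mono) auto
  finally show False using growth by (simp add: mult_ac)
qed

text \<open>Each product is m^k plus a nonnegative excess. On the first part m^k <= 1 is used, on
  the excess g <= C; the total excess is controlled by the sum of y alone, so no upper bound on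
  individual entries is required.\<close>

lemma weighted_sum_le_sum_plus_deviation:
  fixes g :: "'a set \<Rightarrow> real"
  assumes V: "finite V" and y: "\<And>i. i \<in> V \<Longrightarrow> m \<le> y i" and m: "0 \<le> m" "m \<le> 1"
    and g: "\<And>J. J \<in> ksubsets V k \<Longrightarrow> 0 \<le> g J \<and> g J \<le> C" and S: "sum y V \<le> S" and C: "0 \<le> C"
  shows "weighted_sum k g V y \<le> sum g (ksubsets V k) + C * (S ^ k / fact k - m ^ k * real (card V choose k))"
proof -
  have y0: "0 \<le> y i" if "i \<in> V" for i using y[OF that] m by simp
  have lower: "m ^ k \<le> (\<Prod>i\<in>J. y i)" if "J \<in> ksubsets V k" for J
  proof -
    have "(\<Prod>i\<in>J. m) \<le> (\<Prod>i\<in>J. y i)"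
      using that y m by (intro prod_mono) (auto simp: ksubsets_def)
    then show ?thesis using that by (simp add: ksubsets_def)
  qed
  have "weighted_sum k g V y
      = (\<Sum>J\<in>ksubsets V k. g J * ((\<Prod>i\<in>J. y i) - m ^ k) + g J * m ^ k)"
    by (simp add: weighted_sum_def algebra_simps)
  also have "\<dots> \<le> (\<Sum>J\<in>ksubsets V k. C * ((\<Prod>i\<in>J. y i) - m ^ k) + g J * 1)"
    using g lower m by (intro sum_mono add_mono mult_right_mono mult_left_mono power_le_one) auto
  also have "\<dots> = C * (elem_sym k V y - m ^ k * real (card V choose k)) + sum g (ksubsets V k)"
    by (simp add: weighted_sum_def sum.distrib sum_subtractf sum_distrib_left[symmetric]
        card_ksubsets[OF V] mult.commute)
  also have "elem_sym k V y \<le> sum y V ^ k / fact k"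
    using V y0 by (rule elem_sym_le)
  also have "\<dots> \<le> S ^ k / fact k"
    using S y0 by (intro divide_right_mono power_mono sum_nonneg) auto
  finally show ?thesis using C by (simp add: mult_left_mono)
qed

section \<open>Extremal densities and the size of the spectral maximum\<close>

text \<open>The absence of isolated vertices enters only through \<open>nonempty\<close>, which
  guarantees that all maxima below are attained.\<close>

locale generalized_turan =
  fixes p :: real and r s :: nat and Q :: hg and \<F> :: "hg set"
  assumes p: "1 < p" and s: "2 \<le> s" and Q: "is_rgraph r Q" "card (fst Q) = s"
    and nonempty: "\<And>n. Ffree_n r \<F> n \<noteq> {}"
    and pi_pos: "0 < pi_dens r Q \<F>"
begin

abbreviation \<pi> :: real where "\<pi> \<equiv> pi_dens r Q \<F>"

text \<open>Unlike \<open>Ffree_n\<close> this allows any vertex set, so that induced subgraphs are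
  again \<open>free\<close> for their own number of vertices.\<close>

definition free :: "nat \<Rightarrow> hg \<Rightarrow> bool" where
  "free n H \<longleftrightarrow> is_rgraph r H \<and> F_free \<F> H \<and> card (fst H) = n"

definition copies :: "hg \<Rightarrow> nat set \<Rightarrow> real" where
  "copies H I = real (num_copies Q (induced H I))"

lemma p0: "0 < p"
  using p by simp

lemma freeD:
  assumes "free n H"
  shows "is_rgraph r H" "F_free \<F> H" "card (fst H) = n" "finite (fst H)" "snd H \<subseteq> Pow (fst H)"
  using assms by (auto simp: free_def is_rgraph_def)

lemma Ffree_n_free: "H \<in> Ffree_n r \<F> n \<Longrightarrow> free n H"
  by (simp add: Ffree_n_def free_def)

lemma copies_nonneg: "0 \<le> copies H I"
  by (simp add: copies_def)

lemma copies_le_fact: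
  assumes "finite I" "card I = s"
  shows "copies H I \<le> fact s"
proof -
  have "num_copies Q (induced H I) \<le> fact s"
    using num_copies_induced_le_fact[OF is_rgraphD(2)[OF Q(1)], of I H] assms Q by simp
  then have "real (num_copies Q (induced H I)) \<le> real (fact s)"
    by (simp only: of_nat_le_iff)
  then show ?thesis unfolding copies_def by simp
qed

lemma Ppoly_eq: "Ppoly Q H x = fact s * weighted_sum s (copies H) (fst H) x"
  by (simp add: Ppoly_eq_weighted_sum Q copies_def[abs_def])

lemma num_copies_eq_sum:
  assumes H: "free n H" and K: "K \<subseteq> fst H"
  shows "real (num_copies Q (induced H K)) = (\<Sum>I\<in>ksubsets K s. copies H I)"
proof -
  have "finite K" using finite_subset[OF K freeD(4)[OF H]] .
  then have "num_copies Q (induced H K) = (\<Sum>I\<in>ksubsets K s. num_copies Q (induced (induced H K) I))"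
    using num_copies_eq_sum_induced[of "induced H K" Q] snd_induced_subset Q by simp
  also have "\<dots> = (\<Sum>I\<in>ksubsets K s. num_copies Q (induced H I))"
    by (intro sum.cong) (auto simp: ksubsets_def induced_induced)
  finally show ?thesis by (simp add: copies_def)
qed

lemma num_copies_free: "free n H \<Longrightarrow> real (num_copies Q H) = (\<Sum>I\<in>ksubsets (fst H) s. copies H I)"
proof -
  assume H: "free n H"
  have "induced H (fst H) = H"
    using freeD(5)[OF H] by (auto simp: induced_def prod_eq_iff)
  then show ?thesis using num_copies_eq_sum[OF H, of "fst H"] by simp
qed

lemma sum_copies_le_ex_num:
  assumes H: "free n H" and K: "K \<in> ksubsets (fst H) k"
  shows "(\<Sum>I\<in>ksubsets K s. copies H I) \<le> real (ex_num r Q \<F> k)"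
proof -
  have K: "K \<subseteq> fst H" "card K = k" using K by (auto simp: ksubsets_def)
  have "num_copies Q (induced H K) \<le> ex_num r Q \<F> k"
    using freeD[OF H] K by (intro num_copies_le_ex_num is_rgraph_induced F_free_induced) simp_all
  then show ?thesis using num_copies_eq_sum[OF H K(1)] by simp
qed

text \<open>The density of an extremal graph is the average of the densities of its induced k-vertex
  subgraphs, each of them free.\<close>

lemma ex_density_antimono:
  assumes "s \<le> k" "k \<le> n"
  shows "real (ex_num r Q \<F> n) / real (n choose s) \<le> real (ex_num r Q \<F> k) / real (k choose s)"
proof -
  obtain H where "H \<in> Ffree_n r \<F> n" "num_copies Q H = ex_num r Q \<F> n"
    using ex_num_attained[OF nonempty] by metis
  then have H: "free n H" and ex: "real (ex_num r Q \<F> n) = (\<Sum>I\<in>ksubsets (fst H) s. copies H I)"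
    using Ffree_n_free num_copies_free by metis+
  note V = freeD(3,4)[OF H]
  have elem: "elem_sym (k - s) (fst H - I) (\<lambda>_. 1) = real ((n - s) choose (k - s))"
    if I: "I \<in> ksubsets (fst H) s" for I
  proof -
    have "card (fst H - I) = n - s"
      using I V finite_in_ksubsets[OF V(2) I] by (auto simp: ksubsets_def card_Diff_subset)
    then show ?thesis using V by (simp add: weighted_sum_def card_ksubsets)
  qed
  have "real (ex_num r Q \<F> n) * real ((n - s) choose (k - s))
      = (\<Sum>I\<in>ksubsets (fst H) s. copies H I * (\<Prod>i\<in>I. 1) * elem_sym (k - s) (fst H - I) (\<lambda>_. 1))"
    using elem by (simp add: ex sum_distrib_right)
  also have "\<dots> = (\<Sum>K\<in>ksubsets (fst H) k. (\<Sum>I\<in>ksubsets K s. copies H I) * (\<Prod>i\<in>K. 1))"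
    by (rule weighted_sum_average[OF V(2) assms(1), symmetric])
  also have "\<dots> \<le> (\<Sum>K\<in>ksubsets (fst H) k. real (ex_num r Q \<F> k))"
    using sum_copies_le_ex_num[OF H] by (intro sum_mono) simp
  also have "\<dots> = real (n choose k) * real (ex_num r Q \<F> k)"
    using V by (simp add: card_ksubsets)
  finally have "real (ex_num r Q \<F> n) * real ((n - s) choose (k - s)) * real (k choose s)
      \<le> real (n choose k) * real (ex_num r Q \<F> k) * real (k choose s)"
    by (rule mult_right_mono) simp
  also have "\<dots> = real ((n choose k) * (k choose s)) * real (ex_num r Q \<F> k)"
    by simp
  also have "(n choose k) * (k choose s) = (n choose s) * ((n - s) choose (k - s))"
    using assms by (intro choose_mult)
  finally have "real ((n - s) choose (k - s)) * (real (ex_num r Q \<F> n) * real (k choose s))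
      \<le> real ((n - s) choose (k - s)) * (real (ex_num r Q \<F> k) * real (n choose s))"
    by (simp add: mult_ac)
  moreover have "0 < real ((n - s) choose (k - s))" "0 < real (n choose s)" "0 < real (k choose s)"
    using assms by (simp_all add: zero_less_binomial_iff)
  ultimately show ?thesis by (simp add: field_simps)
qed

text \<open>\<open>pi_dens\<close> is defined by \<open>lim\<close>, so convergence has to be proved
  before the value can be used; monotonicity and the lower bound 0 provide it.\<close>

lemma ex_density_tendsto: "(\<lambda>n. real (ex_num r Q \<F> n) / real (n choose s)) \<longlonglongrightarrow> \<pi>"
proof -
  let ?e = "\<lambda>n. real (ex_num r Q \<F> n) / real (n choose s)"
  \<comment> \<open>The shift by s matters: below s the binomial coefficient is 0 and the quotient
    is 0 by convention.\<close>
  have "decseq (\<lambda>n. ?e (n + s))"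
    by (intro decseq_SucI ex_density_antimono) auto
  then obtain L where "(\<lambda>n. ?e (n + s)) \<longlonglongrightarrow> L"
    by (rule decseq_convergent[of _ 0]) auto
  then have "?e \<longlonglongrightarrow> L" by (rule LIMSEQ_offset)
  then show ?thesis using limI[of ?e L] by (simp add: pi_dens_def Q)
qed

lemma ex_num_le: "real (ex_num r Q \<F> n) \<le> fact s * real (n choose s)"
proof -
  obtain H where "H \<in> Ffree_n r \<F> n" "num_copies Q H = ex_num r Q \<F> n"
    using ex_num_attained[OF nonempty] by metis
  then have H: "free n H" and ex: "real (ex_num r Q \<F> n) = (\<Sum>I\<in>ksubsets (fst H) s. copies H I)"
    using Ffree_n_free num_copies_free by metis+
  note V = freeD(3,4)[OF H]
  have "(\<Sum>I\<in>ksubsets (fst H) s. copies H I) \<le> (\<Sum>I\<in>ksubsets (fst H) s. fact s)"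
    using finite_in_ksubsets[OF V(2)] by (intro sum_mono copies_le_fact) (auto simp: ksubsets_def)
  then show ?thesis using V by (simp add: ex card_ksubsets mult.commute)
qed

text \<open>Serves twice: it makes the threshold \<open>c\<close> in \<open>lam_upper_bound\<close>
  at most 1, and it lets s! dominate \<pi> in the choice of \<sigma>.\<close>

lemma pi_le_fact: "\<pi> \<le> fact s"
proof (rule LIMSEQ_le_const2[OF ex_density_tendsto], intro exI allI impI)
  fix n assume "s \<le> n"
  then show "real (ex_num r Q \<F> n) / real (n choose s) \<le> fact s"
    using ex_num_le[of n] by (simp add: divide_le_eq zero_less_binomial_iff)
qed

text \<open>The all-ones vector, whose p-th powers sum to n, is tested on a graph with the most
  copies of Q.\<close>

lemma lam_class_ge:
  assumes "0 < n"
  shows "fact s * real (ex_num r Q \<F> n) \<le> lam_class p Q (Ffree_n r \<F> n) * real n powr (real s / p)"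
proof -
  obtain H where "H \<in> Ffree_n r \<F> n" "num_copies Q H = ex_num r Q \<F> n"
    using ex_num_attained[OF nonempty] by metis
  then have H: "free n H" and ex: "real (ex_num r Q \<F> n) = (\<Sum>I\<in>ksubsets (fst H) s. copies H I)"
    using Ffree_n_free num_copies_free by metis+
  note V = freeD(3,4)[OF H]
  have "fact s * real (ex_num r Q \<F> n) = Ppoly Q H (\<lambda>_. 1)"
    by (simp add: Ppoly_eq weighted_sum_def ex)
  also have "\<dots> \<le> lam p Q H * (\<Sum>i\<in>fst H. 1 powr p) powr (real s / p)"
    using Ppoly_le_lam[of H p Q "\<lambda>_. 1"] V assms p s Q by force
  also have "\<dots> = lam p Q H * real n powr (real s / p)"
    using V by simp
  also have "\<dots> \<le> lam_class p Q (Ffree_n r \<F> n) * real n powr (real s / p)"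
    using freeD[OF H] assms p by (intro mult_right_mono lam_le_lam_class) auto
  finally show ?thesis .
qed

text \<open>Rescale an optimal vector to mean \<open>p\<close>-th power 1, so that its entries sum to at most \<open>n\<close>. If the
  sum is below \<open>c n\<close>, bounding every number of copies by \<open>s!\<close> suffices; otherwise no entry is a positive
  proportion of the sum, because every entry is at most \<open>n\<close> to the power \<open>1/p < 1\<close>, and averaging over \<open>k\<close>-subsets applies.\<close>
lemma lam_upper_bound:
  assumes \<delta>: "0 < \<delta>"
  shows "\<forall>\<^sub>F n in sequentially. \<forall>H. free n H \<longrightarrow>
    lam p Q H \<le> (\<pi> + \<delta>) * real n powr (real s - real s / p)"
proof -
  have "\<forall>\<^sub>F k in sequentially. s \<le> k \<and> real (ex_num r Q \<F> k) / real (k choose s) < \<pi> + \<delta> / 2"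
    using eventually_ge_at_top[of s] order_tendstoD(2)[OF ex_density_tendsto, of "\<pi> + \<delta> / 2"] \<delta>
    by (intro eventually_conj) auto
  then obtain k where k: "s \<le> k" "real (ex_num r Q \<F> k) / real (k choose s) < \<pi> + \<delta> / 2"
    by (auto simp: eventually_sequentially)
  \<comment> \<open>Chosen so that s! c^s <= s! c = \<pi>, which settles the case of a small
    sum.\<close>
  define c where "c = \<pi> / fact s"
  have c: "0 < c" "c \<le> 1" using pi_pos pi_le_fact by (auto simp: c_def)
  \<comment> \<open>If S >= c n and the entries are at most n^(1/p), then k times the largest entry
    is at most (1 - q n) S. As p > 1, q tends to 1; k stays fixed while n grows.\<close>
  define q where "q = (\<lambda>n::nat. 1 - real k / c * real n powr (1 / p - 1))"
  have "(\<lambda>n. real n powr (1 / p - 1)) \<longlonglongrightarrow> 0"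
    using p by (intro tendsto_neg_powr filterlim_real_sequentially) simp
  then have "q \<longlonglongrightarrow> 1 - real k / c * 0"
    unfolding q_def by (intro tendsto_intros)
  then have q: "q \<longlonglongrightarrow> 1" by simp
  then have "(\<lambda>n. q n ^ (k - s) * (\<pi> + \<delta>)) \<longlonglongrightarrow> 1 ^ (k - s) * (\<pi> + \<delta>)"
    by (intro tendsto_intros)
  then have "\<forall>\<^sub>F n in sequentially. \<pi> + \<delta> / 2 < q n ^ (k - s) * (\<pi> + \<delta>)"
    using \<delta> by (intro order_tendstoD(1)[of _ "\<pi> + \<delta>"]) auto
  moreover have "\<forall>\<^sub>F n in sequentially. 0 < q n"
    using order_tendstoD(1)[OF q, of 0] by simp
  ultimately show ?thesis
    using eventually_gt_at_top[of 0]
  proof eventually_elim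
    case (elim n)
    show ?case
    proof (intro allI impI)
      fix H assume H: "free n H"
      note V = freeD(3,4)[OF H]
      have "fst H \<noteq> {}" using V elim by auto
      obtain x where x: "\<And>i. 0 \<le> x i" "(\<Sum>i\<in>fst H. x i powr p) = 1" "lam p Q H = Ppoly Q H x"
        using lam_attained[OF V(2) \<open>fst H \<noteq> {}\<close> p0] by metis
      define M where "M = real n powr (1 / p)"
      have M: "0 < M" "M powr p = real n" "M ^ s = real n powr (real s / p)"
        using elim p by (auto simp: M_def powr_powr powr_realpow[symmetric])
      define y where "y = (\<lambda>i. M * x i)"
      define S where "S = sum y (fst H)"
      have y: "0 \<le> y i \<and> y i \<le> M" if "i \<in> fst H" for i
      proof -
        have "x i powr p \<le> 1"
          using member_le_sum[of i "fst H" "\<lambda>i. x i powr p"] that V x(2) by simp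
        then have "x i \<le> 1"
          using p0 powr_less_mono2[of p 1 "x i"] powr_one_eq_one[of p] by linarith
        then show ?thesis using x(1) M by (simp add: y_def mult_left_le)
      qed
      have "(\<Sum>i\<in>fst H. y i powr p) = real n"
        using x M by (simp add: y_def powr_mult sum_distrib_left[symmetric])
      then have S: "S \<le> real n" "0 \<le> S"
        using sum_le_card_if_sum_powr_eq_card[OF p, of "fst H" y] y V
        by (auto simp: S_def sum_nonneg)
      have Py: "Ppoly Q H y = M ^ s * lam p Q H"
        by (simp add: y_def Ppoly_eq weighted_sum_scale x(3) mult_ac)
      have "Ppoly Q H y \<le> (\<pi> + \<delta>) * real n ^ s"
      proof (cases "S < c * real n")
        case True
        have "weighted_sum s (copies H) (fst H) y \<le> weighted_sum s (\<lambda>_. fact s) (fst H) y"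
        proof (rule weighted_sum_mono)
          fix I assume I: "I \<in> ksubsets (fst H) s"
          then have "card I = s" by (simp add: ksubsets_def)
          then show "copies H I \<le> fact s"
            by (rule copies_le_fact[OF finite_in_ksubsets[OF V(2) I]])
        qed (use y in blast)
        also have "\<dots> = fact s * elem_sym s (fst H) y"
          by (rule weighted_sum_const)
        also have "\<dots> \<le> fact s * (S ^ s / fact s)"
          unfolding S_def using y V
          by (intro mult_left_mono elem_sym_le) auto
        finally have "Ppoly Q H y \<le> fact s * S ^ s"
          by (simp add: Ppoly_eq)
        also have "\<dots> \<le> fact s * (c * real n) ^ s"
          using True S by (intro mult_left_mono power_mono) auto
        also have "\<dots> = fact s * c ^ s * real n ^ s"
          by (simp add: power_mult_distrib)
        also have "\<dots> \<le> fact s * c * real n ^ s"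
          using c s power_decreasing[of 1 s c] by (intro mult_right_mono mult_left_mono) auto
        also have "\<dots> \<le> (\<pi> + \<delta>) * real n ^ s"
          using \<delta> by (intro mult_right_mono) (auto simp: c_def)
        finally show ?thesis .
      next
        case False
        then have Spos: "0 < S" using c elim by (smt (verit) mult_pos_pos of_nat_0_less_iff)
        have "real k * M \<le> (1 - q n) * S"
        proof -
          have "real k * M = real k / c * real n powr (1 / p - 1) * (c * real n)"
            using c elim by (simp add: M_def powr_diff)
          also have "\<dots> \<le> real k / c * real n powr (1 / p - 1) * S"
            using False c by (intro mult_left_mono) auto
          finally show ?thesis by (simp add: q_def)
        qed
        then have SM: "q n * S \<le> S - real k * M" by (simp add: algebra_simps)
        have P0: "0 \<le> Ppoly Q H y"
          unfolding Ppoly_eq using y copies_nonneg by (intro mult_nonneg_nonneg weighted_sum_nonneg) auto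
        have "Ppoly Q H y * q n ^ (k - s) * S ^ (k - s) = Ppoly Q H y * (q n * S) ^ (k - s)"
          by (simp add: power_mult_distrib)
        also have "\<dots> \<le> Ppoly Q H y * (S - real k * M) ^ (k - s)"
          using SM elim Spos P0 by (intro mult_left_mono power_mono) auto
        also have "\<dots> \<le> real (ex_num r Q \<F> k) / real (k choose s) * S ^ k"
          unfolding Ppoly_eq S_def
        proof (rule weighted_sum_le_local_density[OF V(2) k(1) y])
          have "0 \<le> q n * S" using elim Spos by simp
          then show "real k * M \<le> sum y (fst H)" using SM S_def by linarith
        qed (use M copies_nonneg sum_copies_le_ex_num[OF H] in auto)
        also have "\<dots> = real (ex_num r Q \<F> k) / real (k choose s) * S ^ s * S ^ (k - s)"
          using k(1) by (simp add: power_add[symmetric])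
        \<comment> \<open>Cancelling S^(k-s) restores homogeneity of degree s.\<close>
        finally have "Ppoly Q H y * q n ^ (k - s) \<le> real (ex_num r Q \<F> k) / real (k choose s) * S ^ s"
          using Spos by (elim mult_right_le_imp_le) simp
        also have "\<dots> \<le> (\<pi> + \<delta> / 2) * real n ^ s"
          using k(2) S pi_pos \<delta> by (intro mult_mono power_mono) auto
        also have "\<dots> \<le> q n ^ (k - s) * (\<pi> + \<delta>) * real n ^ s"
          using elim by (intro mult_right_mono) auto
        finally have "Ppoly Q H y * q n ^ (k - s) \<le> (\<pi> + \<delta>) * real n ^ s * q n ^ (k - s)"
          by (simp add: mult_ac)
        then show ?thesis using elim by (simp add: mult_le_cancel_right)
      qed
      then have "M ^ s * lam p Q H \<le> (\<pi> + \<delta>) * real n ^ s" by (simp only: Py)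
      then have "lam p Q H \<le> (\<pi> + \<delta>) * (real n ^ s / M ^ s)"
        using M(1) by (simp add: pos_le_divide_eq mult.commute)
      also have "real n ^ s / M ^ s = real n powr (real s - real s / p)"
        using elim by (simp add: M powr_diff powr_realpow)
      finally show "lam p Q H \<le> (\<pi> + \<delta>) * real n powr (real s - real s / p)" .
    qed
  qed
qed

section \<open>From the growth hypothesis to the minimum degree\<close>

text \<open>Split the polynomial at u: by the Lagrange condition the terms through u amount to the
  fraction s t of the whole, where t = \<open>x u powr p\<close>. The rest is the polynomial of the
  graph without u, at a vector whose p-th powers sum to 1 - t.\<close>

lemma deletion_inequality:
  assumes H: "free n H" and n: "2 \<le> n" and u: "u \<in> fst H"
    and x: "\<And>i. 0 \<le> x i" "(\<Sum>i\<in>fst H. x i powr p) = 1" "lam p Q H = Ppoly Q H x"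
  shows "lam p Q H * (1 - real s * x u powr p)
       \<le> lam_class p Q (Ffree_n r \<F> (n - 1)) * (1 - x u powr p) powr (real s / p)"
proof -
  note V = freeD(3,4)[OF H]
  let ?H' = "induced H (fst H - {u})"
  let ?W = "weighted_sum (s - 1) (\<lambda>J. copies H (insert u J)) (fst H - {u}) x"
  have H': "free (n - 1) ?H'"
    using freeD[OF H] u unfolding free_def
    by (auto intro!: is_rgraph_induced F_free_induced)
  have "Ppoly Q ?H' x = fact s * weighted_sum s (copies H) (fst H - {u}) x"
    unfolding Ppoly_eq fst_induced
    by (intro arg_cong2[where f = "(*)"] refl weighted_sum_cong)
      (auto simp: copies_def ksubsets_def induced_induced)
  moreover have "Ppoly Q H x = fact s * weighted_sum s (copies H) (fst H - {u}) x + x u * (fact s * ?W)"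
    unfolding Ppoly_eq using weighted_sum_split[OF V(2) u, of s "copies H" x] s
    by (simp add: algebra_simps)
  moreover have "x u * (fact s * ?W) = lam p Q H * (real s * x u powr p)"
  \<comment> \<open>The Lagrange condition is available only for positive \<open>x u\<close>; at 0
    both sides vanish.\<close>
  proof (cases "x u = 0")
    case False
    then have "0 < x u" using x(1)[of u] by simp
    then have "fact s * ?W = lam p Q H * real s * x u powr (p - 1)"
      using lagrange_coordinate[OF V(2) u p _ x] s Q by (simp add: copies_def)
    then have "x u * (fact s * ?W) = lam p Q H * (real s * (x u * x u powr (p - 1)))"
      by simp
    also have "x u * x u powr (p - 1) = x u powr p"
      using \<open>0 < x u\<close> by (simp add: powr_diff)
    finally show ?thesis .
  qed simp
  ultimately have "lam p Q H * (1 - real s * x u powr p) = Ppoly Q ?H' x"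
    unfolding right_diff_distrib mult_1_right using x(3) by linarith
  also have "\<dots> \<le> lam p Q ?H' * (\<Sum>i\<in>fst ?H'. x i powr p) powr (real s / p)"
  proof -
    have "finite (fst ?H')" "fst ?H' \<noteq> {}"
      using freeD(3,4)[OF H'] n by (auto simp del: fst_induced)
    then show ?thesis
      using Ppoly_le_lam[of ?H' p Q x] p s x(1) Q by simp
  qed
  also have "(\<Sum>i\<in>fst ?H'. x i powr p) = 1 - x u powr p"
    using sum.remove[OF V(2) u, of "\<lambda>i. x i powr p"] x(2) by simp
  also have "lam p Q ?H' * (1 - x u powr p) powr (real s / p)
      \<le> lam_class p Q (Ffree_n r \<F> (n - 1)) * (1 - x u powr p) powr (real s / p)"
    using freeD[OF H'] n p by (intro mult_right_mono lam_le_lam_class) auto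
  finally show ?thesis .
qed

text \<open>The premise \<open>lam_class p Q (Ffree_n r \<F> n) \<le> lam p Q H\<close> says that H
  is extremal. Growth is used only at this n, and the threshold is uniform in H and u.\<close>

lemma extremal_min_degree:
  fixes \<epsilon> \<sigma> :: real
  assumes \<epsilon>: "0 < \<epsilon>" "\<epsilon> < 1" and \<sigma>_def: "\<sigma> = \<epsilon> * \<pi> / (5 * fact s * (real s - 1))"
  shows "\<forall>\<^sub>F n in sequentially. \<forall>H u. free n H \<longrightarrow> u \<in> fst H
    \<longrightarrow> lam_class p Q (Ffree_n r \<F> n) \<le> lam p Q H
    \<longrightarrow> lam_class p Q (Ffree_n r \<F> (n - 1))
         + \<pi> * (real s - real s / p) * (1 - \<sigma>) * real n powr (real s - real s / p - 1)
       \<le> lam_class p Q (Ffree_n r \<F> n)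
    \<longrightarrow> (1 - \<epsilon>) * \<pi> * real (n choose (s - 1)) \<le> real (Qdeg Q H u)"
proof -
  define a where "a = real s - real s / p"
  define b where "b = real s / p"
  have b: "0 < b" "b < real s" "a = real s - b"
    using p s by (auto simp: b_def a_def field_simps)
  have s1: "1 \<le> real s - 1" using s by simp
  have \<sigma>_fact: "5 * (fact s * (real s - 1) * \<sigma>) = \<epsilon> * \<pi>"
    using s1 by (simp add: \<sigma>_def field_simps)
  have "0 < \<sigma>" using \<epsilon> pi_pos s1 by (simp add: \<sigma>_def)
  have \<sigma>_pi: "5 * (\<pi> * \<sigma>) \<le> \<epsilon> * \<pi>"
  proof -
    have "\<pi> * 1 \<le> fact s * (real s - 1)"
      using pi_le_fact s1 by (intro mult_mono) auto
    then have "\<pi> * \<sigma> \<le> fact s * (real s - 1) * \<sigma>"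
      using \<open>0 < \<sigma>\<close> by (intro mult_right_mono) auto
    then show ?thesis using \<sigma>_fact by linarith
  qed
  then have "5 * \<sigma> \<le> \<epsilon>"
    using pi_pos by (simp add: mult_ac)
  then have \<sigma>: "0 < \<sigma>" "\<sigma> < 1 / 2" using \<epsilon> \<open>0 < \<sigma>\<close> by auto

  \<comment> \<open>Normalised counts: \<open>\<rho>\<close> tends to 1 and \<open>l\<close> to
    \<pi>, so the final comparison becomes one of limits.\<close>
  define \<rho> where "\<rho> = (\<lambda>n. fact s * real (n choose s) / real n ^ s)"
  define l where "l = (\<lambda>n. fact s * real (ex_num r Q \<F> n) / real n ^ s)"
  have \<rho>: "\<rho> \<longlonglongrightarrow> 1"
    unfolding \<rho>_def by (rule fact_binomial_over_power_tendsto)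
  have "(\<lambda>n. real (ex_num r Q \<F> n) / real (n choose s) * \<rho> n) \<longlonglongrightarrow> \<pi> * 1"
    by (intro tendsto_mult ex_density_tendsto \<rho>)
  moreover have "\<forall>\<^sub>F n in sequentially. real (ex_num r Q \<F> n) / real (n choose s) * \<rho> n = l n"
    using eventually_ge_at_top[of s]
    by eventually_elim (simp add: \<rho>_def l_def zero_less_binomial_iff)
  ultimately have l: "l \<longlonglongrightarrow> \<pi>"
    by (simp add: tendsto_cong)

  have ev1: "\<forall>\<^sub>F n in sequentially. (1 + \<sigma>) * (1 - 2 * \<sigma>) * (a + real s * b / real n) < a * (1 - \<sigma>)"
  proof (rule order_tendstoD(2))
    have "(\<lambda>n. (1 + \<sigma>) * (1 - 2 * \<sigma>) * (a + real s * b * (1 / real n)))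
        \<longlonglongrightarrow> (1 + \<sigma>) * (1 - 2 * \<sigma>) * (a + real s * b * 0)"
      by (intro tendsto_intros lim_1_over_n)
    then show "(\<lambda>n. (1 + \<sigma>) * (1 - 2 * \<sigma>) * (a + real s * b / real n))
        \<longlonglongrightarrow> (1 + \<sigma>) * (1 - 2 * \<sigma>) * a"
      by simp
    have "0 < a * (2 * \<sigma> * \<sigma>)" using b \<sigma> by simp
    then show "(1 + \<sigma>) * (1 - 2 * \<sigma>) * a < a * (1 - \<sigma>)"
      by (simp add: algebra_simps)
  qed
  \<comment> \<open>The expression is positive exactly when a degree below the claimed bound is
    impossible: \<open>(1 - 2 * \<sigma>) * l n\<close> bounds the normalised weighted link from
    below, \<open>(1 - \<epsilon>) * \<pi>\<close> is the supposed degree, and the s! term is the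
    excess.\<close>
  have ev2: "\<forall>\<^sub>F n in sequentially.
      0 < (1 - 2 * \<sigma>) * l n - ((1 - \<epsilon>) * \<pi> + fact s * (1 - (1 - 2 * \<sigma> * (real s - 1)) * \<rho> n))"
  proof (rule order_tendstoD(1))
    show "(\<lambda>n. (1 - 2 * \<sigma>) * l n - ((1 - \<epsilon>) * \<pi> + fact s * (1 - (1 - 2 * \<sigma> * (real s - 1)) * \<rho> n)))
        \<longlonglongrightarrow> (1 - 2 * \<sigma>) * \<pi> - ((1 - \<epsilon>) * \<pi> + fact s * (1 - (1 - 2 * \<sigma> * (real s - 1)) * 1))"
      by (intro tendsto_intros l \<rho>)
    have "(1 - 2 * \<sigma>) * \<pi> - ((1 - \<epsilon>) * \<pi> + fact s * (1 - (1 - 2 * \<sigma> * (real s - 1)) * 1))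
        = \<epsilon> * \<pi> - 2 * (\<pi> * \<sigma>) - 2 * (fact s * (real s - 1) * \<sigma>)"
      by (simp add: algebra_simps)
    also have "\<dots> > 0"
      using \<sigma>_fact \<sigma>_pi \<epsilon> pi_pos mult_pos_pos[OF \<epsilon>(1) pi_pos] by linarith
    finally show "0 < (1 - 2 * \<sigma>) * \<pi> - ((1 - \<epsilon>) * \<pi> + fact s * (1 - (1 - 2 * \<sigma> * (real s - 1)) * 1))" .
  qed
  have ev3: "\<forall>\<^sub>F n in sequentially. \<forall>H. free n H \<longrightarrow> lam p Q H \<le> \<pi> * (1 + \<sigma>) * real n powr a"
    using lam_upper_bound[of "\<pi> * \<sigma>"] pi_pos \<sigma> by (simp add: a_def distrib_left)
  show ?thesis
    unfolding a_def[symmetric]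
    using ev1 ev2 ev3 eventually_ge_at_top[of s]
  proof eventually_elim
    case (elim n)
    show ?case
    proof (intro allI impI)
      fix H u
      assume H: "free n H" and u: "u \<in> fst H"
        and ext: "lam_class p Q (Ffree_n r \<F> n) \<le> lam p Q H"
        and growth: "lam_class p Q (Ffree_n r \<F> (n - 1)) + \<pi> * a * (1 - \<sigma>) * real n powr (a - 1)
          \<le> lam_class p Q (Ffree_n r \<F> n)"
      note V = freeD(3,4)[OF H]
      have n: "2 \<le> n" "0 < real n" using elim s by auto
      define L where "L = lam p Q H"
      have Lge: "fact s * real (ex_num r Q \<F> n) \<le> L * real n powr b"
      proof -
        have "fact s * real (ex_num r Q \<F> n) \<le> lam_class p Q (Ffree_n r \<F> n) * real n powr b"
          using lam_class_ge[of n] n by (simp add: b_def)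
        also have "\<dots> \<le> L * real n powr b"
          using ext by (intro mult_right_mono) (auto simp: L_def)
        finally show ?thesis .
      qed
      then have "0 \<le> L * real n powr b" by (rule order_trans[rotated]) simp
      then have L0: "0 \<le> L" using n by (simp add: zero_le_mult_iff)
      obtain x where x: "\<And>i. 0 \<le> x i" "(\<Sum>i\<in>fst H. x i powr p) = 1" "lam p Q H = Ppoly Q H x"
        using lam_attained[OF V(2) _ p0] u by (metis empty_iff)
      have weight: "(1 - 2 * \<sigma>) / real n \<le> x v powr p" if v: "v \<in> fst H" for v
      proof (rule weight_lower_bound)
        show "L * (1 - real s * x v powr p)
            \<le> lam_class p Q (Ffree_n r \<F> (n - 1)) * (1 - x v powr p) powr b"
          using deletion_inequality[OF H n(1) v x] by (simp add: L_def b_def)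
        show "lam_class p Q (Ffree_n r \<F> (n - 1)) + \<pi> * a * (1 - \<sigma>) * real n powr (a - 1) \<le> L"
          using growth ext by (simp add: L_def)
        show "L \<le> \<pi> * (1 + \<sigma>) * real n powr a"
          using elim H unfolding L_def by blast
      qed (use elim n b \<sigma> pi_pos L0 in auto)

      \<comment> \<open>Rescaling to mean p-th power 1 turns the weight bound into y >= m for all
        entries.\<close>
      define M where "M = real n powr (1 / p)"
      have M: "0 < M" "M powr p = real n"
        using n p by (auto simp: M_def powr_powr)
      define y where "y = (\<lambda>i. M * x i)"
      define m where "m = (1 - 2 * \<sigma>) powr (1 / p)"
      have y_ge: "m \<le> y v" if "v \<in> fst H" for v
      proof -
        have "((1 - 2 * \<sigma>) / real n) powr (1 / p) \<le> (x v powr p) powr (1 / p)"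
          using weight[OF that] p \<sigma> n by (intro powr_mono2) auto
        also have "\<dots> = x v" using p x(1) by (simp add: powr_powr)
        finally have "m / M \<le> x v"
          using \<sigma> n by (simp add: powr_divide m_def M_def)
        then show ?thesis using M by (simp add: y_def field_simps)
      qed
      have sum_y: "sum y (fst H) \<le> real n"
      proof -
        have "(\<Sum>i\<in>fst H. y i powr p) = real n"
          using x M by (simp add: y_def powr_mult sum_distrib_left[symmetric])
        then show ?thesis
          using sum_le_card_if_sum_powr_eq_card[OF p, of "fst H" y] x M V by (simp add: y_def)
      qed
      have m: "1 - 2 * \<sigma> \<le> m" "m \<le> 1"
      proof -
        have "(1 - 2 * \<sigma>) powr 1 \<le> (1 - 2 * \<sigma>) powr (1 / p)"
          using p \<sigma> by (intro powr_mono') auto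
        then show "1 - 2 * \<sigma> \<le> m" using \<sigma> by (simp add: m_def)
        show "m \<le> 1" using p \<sigma> by (simp add: m_def powr_le1)
      qed
      \<comment> \<open>Bernoulli makes the loss linear in \<sigma>; this is where the factor s - 1
        in the definition of \<sigma> comes from.\<close>
      have m_pow: "1 - 2 * \<sigma> * (real s - 1) \<le> m ^ (s - 1)"
      proof -
        have "1 + real (s - 1) * (- (2 * \<sigma>)) \<le> (1 + - (2 * \<sigma>)) ^ (s - 1)"
          using \<sigma> by (intro Bernoulli_inequality) auto
        also have "\<dots> \<le> m ^ (s - 1)"
          using m \<sigma> by (intro power_mono) auto
        finally show ?thesis using s by (simp add: of_nat_diff algebra_simps)
      qed

      have deg: "real (Qdeg Q H u) = (\<Sum>J\<in>ksubsets (fst H - {u}) (s - 1). copies H (insert u J))"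
        using Qdeg_eq_sum[OF V(2) u, of Q] s Q by (simp add: copies_def)
      have "weighted_sum (s - 1) (\<lambda>J. copies H (insert u J)) (fst H - {u}) y
          \<le> real (Qdeg Q H u) + fact s * (real n ^ (s - 1) / fact (s - 1)
               - m ^ (s - 1) * real (card (fst H - {u}) choose (s - 1)))"
        unfolding deg
      proof (rule weighted_sum_le_sum_plus_deviation)
        show "sum y (fst H - {u}) \<le> real n"
        proof -
          have "0 \<le> y u" using x(1) M by (simp add: y_def)
          then show ?thesis using sum.remove[OF V(2) u, of y] sum_y by linarith
        qed
        show "0 \<le> copies H (insert u J) \<and> copies H (insert u J) \<le> fact s"
          if "J \<in> ksubsets (fst H - {u}) (s - 1)" for J
        proof -
          have ins: "insert u J \<in> ksubsets (fst H) s"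
            using bij_betwE[OF bij_betw_insert_ksubsets[OF V(2) u, of s]] that s by auto
          then have "card (insert u J) = s" by (simp add: ksubsets_def)
          then show ?thesis
            using copies_le_fact[OF finite_in_ksubsets[OF V(2) ins]] copies_nonneg by simp
        qed
      qed (use V y_ge m \<sigma> in auto)
      moreover have "card (fst H - {u}) = n - 1" using V u by simp
      ultimately have upper: "weighted_sum (s - 1) (\<lambda>J. copies H (insert u J)) (fst H - {u}) y
          \<le> real (Qdeg Q H u) + fact s * (real n ^ (s - 1) / fact (s - 1)
               - m ^ (s - 1) * real ((n - 1) choose (s - 1)))"
        by simp

      \<comment> \<open>Write \<open>x u powr (p - 1)\<close> as the power 1 - 1/p of the weight.
        Since 0 < 1 - 2\<sigma> < 1, lowering the exponent from 1 to 1 - 1/p only increases its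
        power.\<close>
      have xu: "(1 - 2 * \<sigma>) * real n powr (1 / p - 1) \<le> x u powr (p - 1)"
      proof -
        have "(1 - 2 * \<sigma>) * real n powr (1 / p - 1) \<le> (1 - 2 * \<sigma>) powr (1 - 1 / p) * real n powr (1 / p - 1)"
          using powr_mono'[of "1 - 1 / p" 1 "1 - 2 * \<sigma>"] p \<sigma> by (intro mult_right_mono) auto
        also have "\<dots> = ((1 - 2 * \<sigma>) / real n) powr (1 - 1 / p)"
          using n \<sigma> by (simp add: powr_divide powr_diff)
        also have "\<dots> \<le> (x u powr p) powr (1 - 1 / p)"
          using weight[OF u] p \<sigma> n by (intro powr_mono2) auto
        also have "\<dots> = x u powr (p - 1)"
          using p by (simp add: powr_powr algebra_simps)
        finally show ?thesis .
      qed
      have "0 < x u powr p"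
      proof -
        have "0 < (1 - 2 * \<sigma>) / real n" using \<sigma> n by simp
        then show ?thesis using weight[OF u] by linarith
      qed
      then have "0 < x u" using x(1)[of u] by (cases "x u = 0") auto
      have "(1 - 2 * \<sigma>) * real s * (fact s * real (ex_num r Q \<F> n)) / real n
          \<le> (1 - 2 * \<sigma>) * real s * (L * real n powr b) / real n"
        using Lge \<sigma> n by (intro divide_right_mono mult_left_mono) auto
      \<comment> \<open>The factor \<open>M ^ (s - 1)\<close> is what passing from x to y costs in
        the link polynomial, which is homogeneous of degree s - 1; the powers of n combine to s/p -
        1.\<close>
      also have "\<dots> = L * real s * ((1 - 2 * \<sigma>) * real n powr (1 / p - 1)) * M ^ (s - 1)"
      proof -
        have "M ^ (s - 1) = real n powr ((real s - 1) / p)"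
          using n s by (simp add: M_def powr_powr powr_realpow[symmetric] of_nat_diff)
        then have "real n powr (1 / p - 1) * M ^ (s - 1) = real n powr (b - 1)"
          by (simp add: powr_add[symmetric] b_def diff_divide_distrib)
        also have "\<dots> = real n powr b / real n"
          using n by (simp add: powr_diff)
        finally have "L * real s * (1 - 2 * \<sigma>) * (real n powr (1 / p - 1) * M ^ (s - 1))
            = L * real s * (1 - 2 * \<sigma>) * (real n powr b / real n)" by simp
        then show ?thesis by (simp add: mult_ac)
      qed
      also have "\<dots> \<le> L * real s * x u powr (p - 1) * M ^ (s - 1)"
        using xu L0 M by (intro mult_right_mono mult_left_mono) auto
      also have "\<dots> = fact s * weighted_sum (s - 1) (\<lambda>J. copies H (insert u J)) (fst H - {u}) x * M ^ (s - 1)"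
        using lagrange_coordinate[OF V(2) u p _ x \<open>0 < x u\<close>] s Q by (simp add: L_def copies_def)
      also have "\<dots> = fact s * weighted_sum (s - 1) (\<lambda>J. copies H (insert u J)) (fst H - {u}) y"
        by (simp add: y_def weighted_sum_scale mult_ac)
      also have "\<dots> \<le> fact s * (real (Qdeg Q H u) + fact s * (real n ^ (s - 1) / fact (s - 1)
               - m ^ (s - 1) * real ((n - 1) choose (s - 1))))"
        using upper by (intro mult_left_mono) auto
      finally have "fact s * ((1 - 2 * \<sigma>) * real s * real (ex_num r Q \<F> n) / real n)
          \<le> fact s * (real (Qdeg Q H u) + fact s * (real n ^ (s - 1) / fact (s - 1)
               - m ^ (s - 1) * real ((n - 1) choose (s - 1))))"
        by (simp add: mult_ac)
      then have main: "(1 - 2 * \<sigma>) * real s * real (ex_num r Q \<F> n) / real n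
          \<le> real (Qdeg Q H u) + fact s * (real n ^ (s - 1) / fact (s - 1)
               - m ^ (s - 1) * real ((n - 1) choose (s - 1)))"
        by (rule mult_left_le_imp_le) simp
      \<comment> \<open>D is asymptotically the inverse of \<open>n choose (s - 1)\<close>;
        multiplying by it brings \<open>main\<close> into the form of \<open>ev2\<close>.\<close>
      define D where "D = fact (s - 1) / real n ^ (s - 1)"
      have D: "0 < D" using n by (simp add: D_def)
      have facts: "fact s = real s * fact (s - 1)" "real n ^ s = real n * real n ^ (s - 1)"
        using s by (simp_all add: fact_reduce power_eq_if)
      have Dl: "(1 - 2 * \<sigma>) * real s * real (ex_num r Q \<F> n) / real n * D = (1 - 2 * \<sigma>) * l n"
        by (simp add: D_def l_def facts)
      \<comment> \<open>Absorption expresses the count of (s-1)-sets avoiding u exactly through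
        \<open>\<rho> n\<close>, with no further error term.\<close>
      have "real s * real (n choose s) = real n * real ((n - 1) choose (s - 1))"
        using times_binomial_minus1_eq[of s n] s by (metis of_nat_mult less_le_trans zero_less_numeral)
      then have D\<rho>: "real ((n - 1) choose (s - 1)) * D = \<rho> n"
        using n by (simp add: D_def \<rho>_def facts field_simps)
      have "0 \<le> \<rho> n" by (simp add: \<rho>_def)
      show "(1 - \<epsilon>) * \<pi> * real (n choose (s - 1)) \<le> real (Qdeg Q H u)"
      proof (rule ccontr)
        assume "\<not> ?thesis"
        then have "real (Qdeg Q H u) \<le> (1 - \<epsilon>) * \<pi> * real (n choose (s - 1))" by simp
        also have "\<dots> \<le> (1 - \<epsilon>) * \<pi> * (real n ^ (s - 1) / fact (s - 1))"
          using \<epsilon> pi_pos by (intro mult_left_mono binomial_le_power_over_fact) auto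
        finally have "real (Qdeg Q H u) * D \<le> (1 - \<epsilon>) * \<pi> * (real n ^ (s - 1) / fact (s - 1)) * D"
          using D by (intro mult_right_mono) auto
        also have "\<dots> = (1 - \<epsilon>) * \<pi>" using n by (simp add: D_def)
        finally have QD: "real (Qdeg Q H u) * D \<le> (1 - \<epsilon>) * \<pi>" .
        have "(1 - 2 * \<sigma>) * l n \<le> (real (Qdeg Q H u) + fact s * (real n ^ (s - 1) / fact (s - 1)
               - m ^ (s - 1) * real ((n - 1) choose (s - 1)))) * D"
          unfolding Dl[symmetric] using main D by (intro mult_right_mono) auto
        also have "\<dots> = real (Qdeg Q H u) * D + fact s * (real n ^ (s - 1) / fact (s - 1) * D
               - m ^ (s - 1) * (real ((n - 1) choose (s - 1)) * D))"
          by (simp only: distrib_right left_diff_distrib mult.assoc)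
        also have "real n ^ (s - 1) / fact (s - 1) * D = 1" using n by (simp add: D_def)
        also have "real (Qdeg Q H u) * D + fact s * (1 - m ^ (s - 1) * (real ((n - 1) choose (s - 1)) * D))
            \<le> (1 - \<epsilon>) * \<pi> + fact s * (1 - (1 - 2 * \<sigma> * (real s - 1)) * \<rho> n)"
          unfolding D\<rho> using QD m_pow \<open>0 \<le> \<rho> n\<close>
          by (intro add_mono mult_left_mono diff_left_mono mult_right_mono) auto
        finally show False using elim by linarith
      qed
    qed
  qed
qed

end

theorem theorem4p1:
  fixes p \<epsilon> :: real and r s :: nat and Q :: hg and \<F> :: "hg set"
  assumes "p > 1" and "r \<ge> 2" and "s \<ge> r" and "0 < \<epsilon>" and "\<epsilon> < 1"
    and "is_rgraph r Q" and "card (fst Q) = s"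
    and "\<forall>F\<in>\<F>. is_rgraph r F \<and> no_isolated F"
    and "pi_dens r Q \<F> > 0"
  shows "\<exists>N::nat. \<forall>n0\<ge>N.
     (\<forall>n\<ge>n0. lam_class p Q (Ffree_n r \<F> n) \<ge> lam_class p Q (Ffree_n r \<F> (n - 1))
        + pi_dens r Q \<F> * (real s - real s / p)
          * (1 - \<epsilon> * pi_dens r Q \<F> / (5 * fact s * (real s - 1)))
          * real n powr (real s - real s / p - 1))
     \<longrightarrow> (\<forall>n H. n \<ge> n0 \<and> is_rgraph r H \<and> card (fst H) = n \<and> F_free \<F> H \<longrightarrow>
            lam p Q H \<le> lam_class p Q (Gn r Q \<F> \<epsilon> n) \<and>
            (lam p Q H = lam_class p Q (Gn r Q \<F> \<epsilon> n) \<longrightarrow> in_Gn r Q \<F> \<epsilon> n H))"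
proof (cases "({}, {}) \<in> \<F>")
  case True
  \<comment> \<open>If the empty graph is forbidden, no graph is free and the claim is
    vacuous.\<close>
  then show ?thesis using not_F_free_if_empty_mem by blast
next
  case False
  interpret generalized_turan p r s Q \<F>
    using assms Ffree_n_nonempty[OF _ False] by unfold_locales auto
  define \<sigma> where "\<sigma> = \<epsilon> * pi_dens r Q \<F> / (5 * fact s * (real s - 1))"
  let ?\<Lambda> = "\<lambda>n. lam_class p Q (Ffree_n r \<F> n)"
  let ?grow = "\<lambda>n. ?\<Lambda> (n - 1) + pi_dens r Q \<F> * (real s - real s / p) * (1 - \<sigma>)
      * real n powr (real s - real s / p - 1) \<le> ?\<Lambda> n"
  obtain N where N: "\<And>n H u. N \<le> n \<Longrightarrow> free n H \<Longrightarrow> u \<in> fst H \<Longrightarrow> ?\<Lambda> n \<le> lam p Q H \<Longrightarrow> ?grow n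
      \<Longrightarrow> (1 - \<epsilon>) * pi_dens r Q \<F> * real (n choose (s - 1)) \<le> real (Qdeg Q H u)"
    using extremal_min_degree[OF assms(4,5) \<sigma>_def] unfolding eventually_sequentially by blast
  \<comment> \<open>Requiring n >= 1 makes the vertex set nonempty, so that \<open>minQdeg\<close>,
    a \<open>Min\<close>, is attained at some vertex.\<close>
  have extremal: "in_Gn r Q \<F> \<epsilon> n H" if "max N 1 \<le> n" "free n H" "?\<Lambda> n \<le> lam p Q H" "?grow n" for n H
  proof -
    note V = freeD[OF that(2)]
    have "fst H \<noteq> {}" using V that(1) by auto
    then have "minQdeg Q H \<in> Qdeg Q H ` fst H"
      unfolding minQdeg_def using V by (intro Min_in) auto
    then obtain u where u: "u \<in> fst H" "minQdeg Q H = Qdeg Q H u" by blast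
    then show ?thesis
      using N[of n H u] that V Q by (simp add: in_Gn_def)
  qed
  show ?thesis
    unfolding \<sigma>_def[symmetric]
  proof (intro exI[of _ "max N 1"] allI impI)
    fix n0 n H
    assume n0: "max N 1 \<le> n0" and grow: "\<forall>n\<ge>n0. ?grow n"
      and H: "n0 \<le> n \<and> is_rgraph r H \<and> card (fst H) = n \<and> F_free \<F> H"
    have n: "max N 1 \<le> n" "?grow n" using n0 grow H by auto
    have lamH: "lam p Q H \<le> ?\<Lambda> n"
      using H n p0 by (intro lam_le_lam_class) auto
    obtain G where G: "G \<in> Ffree_n r \<F> n" "lam p Q G = ?\<Lambda> n"
      using lam_class_attained[OF nonempty] by metis
    have "in_Gn r Q \<F> \<epsilon> n G"
      using extremal[OF n(1) Ffree_n_free[OF G(1)]] G(2) n(2) by simp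
    then have "G \<in> Gn r Q \<F> \<epsilon> n"
      using G(1) by (simp add: Gn_def Ffree_n_def)
    moreover have "Gn r Q \<F> \<epsilon> n \<subseteq> Ffree_n r \<F> n"
      by (auto simp: Gn_def Ffree_n_def in_Gn_def)
    moreover have "lam p Q G' \<le> ?\<Lambda> n" if "G' \<in> Ffree_n r \<F> n" for G'
      using freeD[OF Ffree_n_free[OF that]] n p0 by (intro lam_le_lam_class) auto
    \<comment> \<open>The class \<open>Gn\<close> contains the maximiser G and lies inside
      \<open>Ffree_n\<close>, so both maxima equal \<open>lam p Q G\<close>.\<close>
    ultimately have "Sup (lam p Q ` Gn r Q \<F> \<epsilon> n) = ?\<Lambda> n"
      using G(2)[symmetric] by (intro cSup_eq_maximum) blast+
    then have "lam_class p Q (Gn r Q \<F> \<epsilon> n) = ?\<Lambda> n"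
      by (simp add: lam_class_def[of p Q "Gn r Q \<F> \<epsilon> n"])
    then show "lam p Q H \<le> lam_class p Q (Gn r Q \<F> \<epsilon> n) \<and>
        (lam p Q H = lam_class p Q (Gn r Q \<F> \<epsilon> n) \<longrightarrow> in_Gn r Q \<F> \<epsilon> n H)"
      using lamH extremal[OF n(1), of H] n(2) H by (auto simp: free_def)
  qed
qed

end
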